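(* Let $\mathcal M,\mathcal N$ be $C^2$-manifolds of dimensions $m,n$, let $\mathcal K\subset\mathcal N$ be a submanifold with corners of dimension $k$, let $f\in C^2(\mathcal M,\mathbb R)$ and $g\in C^2(\mathcal M,\mathcal N)$. Let $p_*\in\mathcal M$ with $q_*=g(p_* )\in\mathcal K$, and let $\mu\in T^*_{q_*}\mathcal N$ satisfy the KKT conditions $$f'(p_* )+\mu\,g'(p_* )=0\ \text{ in }T^*_{p_*}\mathcal M,\qquad \mu\in\bigl(T^i_{q_*}\mathcal K\bigr)^\circ.$$ Let $$C_{\mathcal M}=\{v\in T_{p_*}\mathcal M : g'(p_* )v\in T^i_{q_*}\mathcal K,\ f'(p_* )v=0\}$$ be the critical cone. For a linearizing map $S_{q_*}$ at $q_*$, put $L_{S_{q_*}}(p,\mu)=f(p)+\mu\bigl(S_{q_*}(g(p))\bigr)$ for $p$ near $p_*$. If $S_{q_*,1}$ and $S_{q_*,2}$ are linearizing maps at $q_*$ adapted to $\mathcal K$, then $$L''_{S_{q_*,1}}(p_*,\mu)[v,v]=L''_{S_{q_*,2}}(p_*,\mu)[v,v]\quad\text{for all }v\in C_{\mathcal M}.$$ Denote this common value by $L''(p_*,\mu)[v,v]$. Moreover, for any local retraction $R_{p_*}$ at $p_*$ and any adapted linearizing map $S_{q_*}$ at $q_*$, the function $\bar L(v,\mu)=f(R_{p_*}(v))+\mu\bigl(S_{q_*}(g(R_{p_*}(v)))\bigr)$, defined for $v\in T_{p_*}\mathcal M$ near $0_{p_*}$, satisfies $$L''(p_*,\mu)[v,v]=\bar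 L''(0_{p_*},\mu)[v,v]\quad\text{for all }v\in C_{\mathcal M}.$$
   Context: Manifolds are finite-dimensional and without boundary. A subset $\mathcal K\subset\mathcal N$ is a submanifold with corners of dimension $k$ ($0\le k\le n$) if for each $q\in\mathcal K$ there are a chart $(\mathcal U,\psi)$ of $\mathcal N$ with $q\in\mathcal U$, $\psi(q)=0$, an integer $0\le\ell\le k$, and a surjective linear map $A:\mathbb R^k\times\{0\}^{n-k}\to\mathbb R^\ell$ such that $\psi(\mathcal K\cap\mathcal U)=\{x\in\psi(\mathcal U) : Wx=0,\ Ax\le 0\}$, where $Wx=(x_{k+1},\dots,x_n)^{\mathsf T}$ and $\le$ is componentwise. Such a chart is called an adapted chart centered at $q$; $A$ is identified with the matrix $[\widehat A\ \ 0]\in\mathbb R^{\ell\times n}$. With $v_\psi$ the representative of $v\in T_q\mathcal N$ in an adapted chart $\psi$ centered at $q\in\mathcal K$, $T^i_q\mathcal K=\{v\in T_q\mathcal N : Wv_\psi=0,\ Av_\psi\le0\}$ (independent of the adapted chart). The polar cone of $S\subset V$ is $S^\circ=\{v^*\in V^*:\langle v^*,s\rangle\le0\ \forall s\in S\}$. A local retraction at $p\in\mathcal M$ is a $C^2$-map $R_p:V_{0_p}\to\mathcal M$ on an open neighborhood $V_{0_p}\subset T_p\mathcal M$ of the zero vector $0_p$, with $R_p(0_p)=p$ and $DR_p(0_p)=\mathrm{id}_{T_p\mathcal M}$. A (local) linearizing map at $q\in\mathcal N$ is a $C^2$-map $S_q:\mathcal U_q\to T_q\mathcal N$ on an open neighborhood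 $\mathcal U_q$ of $q$ with $S_q(q)=0_q$ and $DS_q(q)=\mathrm{id}_{T_q\mathcal N}$; it is adapted to $\mathcal K$ if $S_q(\mathcal U_q\cap\mathcal K)=S_q(\mathcal U_q)\cap T^i_q\mathcal K$. Adapted linearizing maps are assumed injective (on a sufficiently small domain). Second derivatives: primes on $L_{S_{q_*}}(\cdot,\mu)$ and $\bar L(\cdot,\mu)$ denote derivatives with respect to the first argument. Under the KKT conditions $p_*$ is a stationary point of $L_{S_{q_*}}(\cdot,\mu)$. At a stationary point $p_*$ of a $C^2$-function $\sigma$ defined near $p_*$ in $\mathcal M$, $\sigma''(p_* )[v,w]:=(\sigma\circ\varphi^{-1})''(\varphi(p_* ))[v_\varphi,w_\varphi]$, where $\varphi$ is any chart around $p_*$ and $v_\varphi,w_\varphi$ are the representatives of $v,w\in T_{p_*}\mathcal M$; this is independent of $\varphi$. *)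

theory Defs
  imports "HOL-Analysis.Analysis"
begin

section \<open>Coordinate spaces\<close>

text \<open>
  The model space \<open>\<real>\<^sup>n\<close> with its ordered standard basis. Compared with \<open>euclidean_space\<close>, the
  basis is ordered (one needs to speak of the last \<open>n - k\<close> coordinates) and it may be empty, so
  that manifolds of dimension 0 are included.
\<close>

class coordinate_space = real_inner +
  fixes std_basis :: "'a list"
  assumes distinct_std_basis: "distinct std_basis"
  assumes inner_std_basis:
    "u \<in> set std_basis \<Longrightarrow> v \<in> set std_basis \<Longrightarrow> inner u v = (if u = v then 1 else 0)"
  assumes std_basis_all_zero_iff: "(\<forall>u\<in>set std_basis. inner x u = 0) \<longleftrightarrow> x = 0"

definition coord_dim :: "'a::coordinate_space itself \<Rightarrow> nat" where
  "coord_dim _ = length (std_basis :: 'a list)"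

text \<open>Coordinates are numbered from 0.\<close>

definition coord :: "'a::coordinate_space \<Rightarrow> nat \<Rightarrow> real" where
  "coord x j = inner x (std_basis ! j)"

instantiation real :: coordinate_space
begin

definition "std_basis = [1::real]"

instance by standard (auto simp: std_basis_real_def)

end

instantiation vec :: (coordinate_space, "{finite, linorder}") coordinate_space
begin

definition
  "std_basis = concat (map (\<lambda>i. map (axis i) std_basis) (sorted_list_of_set UNIV))"

instance
proof
  have inj: "inj (axis i :: 'a \<Rightarrow> ('a, 'b) vec)" for i
    by (auto simp: inj_def axis_eq_axis)
  have zero: "(0::'a) \<notin> set std_basis"
    using inner_std_basis[of "0::'a" 0] by auto
  have dc: "distinct (concat (map (\<lambda>i. map (axis i) (std_basis :: 'a list)) ls))"
    if "distinct ls" for ls :: "'b list"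
    using that
    by (induction ls)
      (use zero inj in \<open>auto simp: distinct_map distinct_std_basis axis_eq_axis
         intro: inj_on_subset\<close>)
  show "distinct (std_basis :: ('a, 'b) vec list)"
    unfolding std_basis_vec_def by (rule dc) simp
  show "inner u v = (if u = v then 1 else 0)"
    if "u \<in> set std_basis" "v \<in> set std_basis" for u v :: "('a, 'b) vec"
    using that zero
    by (auto simp: std_basis_vec_def inner_axis_axis axis_eq_axis inner_std_basis)
  show "(\<forall>u\<in>set std_basis. inner x u = 0) \<longleftrightarrow> x = 0" for x :: "('a, 'b) vec"
    by (auto simp: std_basis_vec_def inner_axis std_basis_all_zero_iff vec_eq_iff)
qed

end

text \<open>\<open>\<real>\<^sup>0\<close>\<close>

datatype origin = Origin

lemma origin_all_eq: "(x::origin) = y"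
  by (cases x; cases y) simp

instantiation origin :: coordinate_space
begin

definition "0 = Origin"
definition "(x::origin) + y = Origin"
definition "(x::origin) - y = Origin"
definition "- (x::origin) = Origin"
definition "scaleR (r::real) (x::origin) = Origin"
definition "norm (x::origin) = (0::real)"
definition "dist (x::origin) (y::origin) = (0::real)"
definition "inner (x::origin) (y::origin) = (0::real)"
definition "sgn (x::origin) = Origin"
definition [code del]:
  "(uniformity :: (origin \<times> origin) filter) = (INF e\<in>{0<..}. principal {(x, y). dist x y < e})"
definition [code del]:
  "open (U :: origin set) = (\<forall>x\<in>U. eventually (\<lambda>(x', y). x' = x \<longrightarrow> y \<in> U) uniformity)"
definition "std_basis = ([] :: origin list)"

instance
  by standard
    (simp_all add: origin_all_eq norm_origin_def dist_origin_def inner_origin_def uniformity_origin_def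
      open_origin_def std_basis_origin_def)

end

section \<open>Maps of class \<open>C\<^sup>2\<close> between open sets of normed spaces\<close>

definition C2_on ::
    "'a::real_normed_vector set \<Rightarrow> ('a \<Rightarrow> 'b::real_normed_vector) \<Rightarrow> bool" where
  "C2_on X f \<longleftrightarrow> open X \<and>
    (\<exists>(f' :: 'a \<Rightarrow> 'a \<Rightarrow>\<^sub>L 'b) (f'' :: 'a \<Rightarrow> 'a \<Rightarrow>\<^sub>L 'a \<Rightarrow>\<^sub>L 'b).
      (\<forall>x\<in>X. (f has_derivative blinfun_apply (f' x)) (at x)) \<and>
      (\<forall>x\<in>X. (f' has_derivative blinfun_apply (f'' x)) (at x)) \<and>
      continuous_on X f'')"

definition second_derivative ::
    "('a::real_normed_vector \<Rightarrow> 'b::real_normed_vector) \<Rightarrow> 'a \<Rightarrow> 'a \<Rightarrow> 'a \<Rightarrow> 'b" where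
  "second_derivative f x v w =
    frechet_derivative (\<lambda>y. frechet_derivative f (at y) v) (at x) w"

section \<open>\<open>C\<^sup>2\<close>-manifolds\<close>

text \<open>
  A chart is a domain together with a coordinate map, whose values outside the domain are
  irrelevant. The points of a manifold are all the points of a topological space, given by a type.
\<close>

type_synonym ('p, 'e) chart = "'p set \<times> ('p \<Rightarrow> 'e)"

abbreviation cdom :: "('p, 'e) chart \<Rightarrow> 'p set" where
  "cdom c \<equiv> fst c"

abbreviation cmap :: "('p, 'e) chart \<Rightarrow> 'p \<Rightarrow> 'e" where
  "cmap c \<equiv> snd c"

definition cinv :: "('p, 'e) chart \<Rightarrow> 'e \<Rightarrow> 'p" where
  "cinv c = inv_into (cdom c) (cmap c)"

definition topological_chart ::
    "('p::topological_space, 'e::real_normed_vector) chart \<Rightarrow> bool" where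
  "topological_chart c \<longleftrightarrow> open (cdom c) \<and> open (cmap c ` cdom c) \<and>
    homeomorphism (cdom c) (cmap c ` cdom c) (cmap c) (cinv c)"

definition C2_compatible :: "('p, 'e::real_normed_vector) chart \<Rightarrow> ('p, 'e) chart \<Rightarrow> bool" where
  "C2_compatible c d \<longleftrightarrow>
    C2_on (cmap c ` (cdom c \<inter> cdom d)) (cmap d \<circ> cinv c) \<and>
    C2_on (cmap d ` (cdom c \<inter> cdom d)) (cmap c \<circ> cinv d)"

text \<open>A manifold is given by its maximal atlas, so that its charts are exactly the members.\<close>

definition C2_manifold ::
    "('p::{t2_space, second_countable_topology}, 'e::coordinate_space) chart set \<Rightarrow> bool" where
  "C2_manifold M \<longleftrightarrow>
    (\<forall>c\<in>M. topological_chart c) \<and>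
    (\<Union>c\<in>M. cdom c) = UNIV \<and>
    (\<forall>c\<in>M. \<forall>d\<in>M. C2_compatible c d) \<and>
    (\<forall>c. topological_chart c \<and> (\<forall>d\<in>M. C2_compatible c d) \<longrightarrow> c \<in> M)"

definition charts_at :: "('p, 'e) chart set \<Rightarrow> 'p \<Rightarrow> ('p, 'e) chart set" where
  "charts_at M p = {c \<in> M. p \<in> cdom c}"

text \<open>
  Used to evaluate chart-independent expressions in some chart around \<open>p\<close>.
\<close>

definition some_chart :: "('p, 'e) chart set \<Rightarrow> 'p \<Rightarrow> ('p, 'e) chart" where
  "some_chart M p = (SOME c. c \<in> charts_at M p)"

text \<open>Maps of class \<open>C\<^sup>2\<close> from an open subset of a normed space into a manifold.\<close>

definition C2_into ::
    "('q::topological_space, 'f::real_normed_vector) chart set \<Rightarrow>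
     'a::real_normed_vector set \<Rightarrow> ('a \<Rightarrow> 'q) \<Rightarrow> bool" where
  "C2_into N X h \<longleftrightarrow> open X \<and> continuous_on X h \<and>
    (\<forall>d\<in>N. C2_on (X \<inter> h -` cdom d) (cmap d \<circ> h))"

definition C2_map ::
    "('p, 'e::real_normed_vector) chart set \<Rightarrow>
     ('q::topological_space, 'f::real_normed_vector) chart set \<Rightarrow> ('p \<Rightarrow> 'q) \<Rightarrow> bool" where
  "C2_map M N g \<longleftrightarrow> (\<forall>c\<in>M. C2_into N (cmap c ` cdom c) (g \<circ> cinv c))"

text \<open>Maps of class \<open>C\<^sup>2\<close> from an open subset of a manifold into a normed space.\<close>

definition C2_fun_on ::
    "('p::topological_space, 'e::real_normed_vector) chart set \<Rightarrow>
     'p set \<Rightarrow> ('p \<Rightarrow> 'b::real_normed_vector) \<Rightarrow> bool" where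
  "C2_fun_on M U f \<longleftrightarrow> open U \<and> (\<forall>c\<in>M. C2_on (cmap c ` (cdom c \<inter> U)) (f \<circ> cinv c))"

section \<open>Tangent spaces\<close>

text \<open>
  A tangent vector \<open>v\<close> at \<open>p\<close> is the family of its chart representatives: \<open>v c\<close> is the
  representative in the chart \<open>c\<close> around \<open>p\<close>. The vector space operations are pointwise.
\<close>

type_synonym ('p, 'e) tangent = "('p, 'e) chart \<Rightarrow> 'e"

definition tangent_space ::
    "('p, 'e::real_normed_vector) chart set \<Rightarrow> 'p \<Rightarrow> ('p, 'e) tangent set" where
  "tangent_space M p = {v.
    (\<forall>c. c \<notin> charts_at M p \<longrightarrow> v c = 0) \<and>
    (\<forall>c\<in>charts_at M p. \<forall>d\<in>charts_at M p.
      v d = frechet_derivative (cmap d \<circ> cinv c) (at (cmap c p)) (v c))}"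

definition tangent_zero :: "('p, 'e::zero) tangent" where
  "tangent_zero = (\<lambda>_. 0)"

text \<open>The tangent vector at \<open>p\<close> with representative \<open>x\<close> in the chart \<open>c\<close>; this is the inverse of
  the linear isomorphism \<open>v \<mapsto> v c\<close> from the tangent space to the model space.\<close>

definition tangent_of ::
    "('p, 'e::real_normed_vector) chart set \<Rightarrow> 'p \<Rightarrow> ('p, 'e) chart \<Rightarrow> 'e \<Rightarrow> ('p, 'e) tangent" where
  "tangent_of M p c x = (\<lambda>d. if d \<in> charts_at M p
     then frechet_derivative (cmap d \<circ> cinv c) (at (cmap c p)) x else 0)"

text \<open>Members of the cotangent space are only relevant on the tangent space.\<close>

definition cotangent_space ::
    "('p, 'e::real_normed_vector) chart set \<Rightarrow> 'p \<Rightarrow> (('p, 'e) tangent \<Rightarrow> real) set" where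
  "cotangent_space M p = {\<mu>.
    (\<forall>v\<in>tangent_space M p. \<forall>w\<in>tangent_space M p. \<mu> (\<lambda>c. v c + w c) = \<mu> v + \<mu> w) \<and>
    (\<forall>r. \<forall>v\<in>tangent_space M p. \<mu> (\<lambda>c. r *\<^sub>R v c) = r * \<mu> v)}"

text \<open>The derivative \<open>f'(p)v\<close> of a map into a normed space.\<close>

definition fun_deriv ::
    "('p, 'e::real_normed_vector) chart set \<Rightarrow> ('p \<Rightarrow> 'b::real_normed_vector) \<Rightarrow>
     'p \<Rightarrow> ('p, 'e) tangent \<Rightarrow> 'b" where
  "fun_deriv M f p v =
    (let c = some_chart M p in frechet_derivative (f \<circ> cinv c) (at (cmap c p)) (v c))"

text \<open>The derivative \<open>g'(p)v\<close>, a tangent vector at \<open>g p\<close>, of a map between manifolds.\<close>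

definition tangent_map ::
    "('p, 'e::real_normed_vector) chart set \<Rightarrow> ('q, 'f::real_normed_vector) chart set \<Rightarrow>
     ('p \<Rightarrow> 'q) \<Rightarrow> 'p \<Rightarrow> ('p, 'e) tangent \<Rightarrow> ('q, 'f) tangent" where
  "tangent_map M N g p v =
    (\<lambda>d. if d \<in> charts_at N (g p) then fun_deriv M (cmap d \<circ> g) p v else 0)"

text \<open>The second derivative on a manifold; chart-independent at a stationary point.\<close>

definition manifold_second_derivative ::
    "('p, 'e::real_normed_vector) chart set \<Rightarrow> ('p \<Rightarrow> real) \<Rightarrow> 'p \<Rightarrow>
     ('p, 'e) tangent \<Rightarrow> ('p, 'e) tangent \<Rightarrow> real" where
  "manifold_second_derivative M \<sigma> p v w =
    (let c = some_chart M p in second_derivative (\<sigma> \<circ> cinv c) (cmap c p) (v c) (w c))"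

text \<open>
  The second derivative at the zero vector of a function on the vector space \<open>T\<^sub>pM\<close>, computed in
  the linear coordinates \<open>v \<mapsto> v c\<close>.
\<close>

definition tangent_second_derivative ::
    "('p, 'e::real_normed_vector) chart set \<Rightarrow> 'p \<Rightarrow> (('p, 'e) tangent \<Rightarrow> real) \<Rightarrow>
     ('p, 'e) tangent \<Rightarrow> ('p, 'e) tangent \<Rightarrow> real" where
  "tangent_second_derivative M p F v w =
    (let c = some_chart M p in second_derivative (F \<circ> tangent_of M p c) 0 (v c) (w c))"

section \<open>Submanifolds with corners\<close>

text \<open>
  The rows \<open>i < l\<close> and columns \<open>j < k\<close> of \<open>A\<close> hold the matrix of a linear map
  \<open>\<real>\<^sup>k \<times> {0}\<^sup>n\<^sup>-\<^sup>k \<rightarrow> \<real>\<^sup>l\<close>; the remaining entries are not used. The condition \<open>Wx = 0\<close> says that \<open>x\<close>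
  lies in the subspace \<open>\<real>\<^sup>k \<times> {0}\<^sup>n\<^sup>-\<^sup>k\<close>.
\<close>

definition corner_row :: "nat \<Rightarrow> (nat \<Rightarrow> nat \<Rightarrow> real) \<Rightarrow> nat \<Rightarrow> 'f::coordinate_space \<Rightarrow> real" where
  "corner_row k A i x = (\<Sum>j<k. A i j * coord x j)"

definition W_zero :: "nat \<Rightarrow> 'f::coordinate_space \<Rightarrow> bool" where
  "W_zero k x \<longleftrightarrow> (\<forall>j. k \<le> j \<and> j < coord_dim TYPE('f) \<longrightarrow> coord x j = 0)"

definition model_corner :: "nat \<Rightarrow> nat \<Rightarrow> (nat \<Rightarrow> nat \<Rightarrow> real) \<Rightarrow> 'f::coordinate_space set" where
  "model_corner k l A = {x. W_zero k x \<and> (\<forall>i<l. corner_row k A i x \<le> 0)}"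

definition adapted_chart ::
    "('q, 'f::coordinate_space) chart set \<Rightarrow> 'q set \<Rightarrow> nat \<Rightarrow> 'q \<Rightarrow>
     ('q, 'f) chart \<Rightarrow> nat \<Rightarrow> (nat \<Rightarrow> nat \<Rightarrow> real) \<Rightarrow> bool" where
  "adapted_chart N K k q c l A \<longleftrightarrow>
    c \<in> charts_at N q \<and> cmap c q = 0 \<and> l \<le> k \<and>
    (\<forall>y. \<exists>x::'f. W_zero k x \<and> (\<forall>i<l. corner_row k A i x = y i)) \<and>
    cmap c ` (K \<inter> cdom c) = cmap c ` cdom c \<inter> model_corner k l A"

definition submanifold_with_corners ::
    "('q, 'f::coordinate_space) chart set \<Rightarrow> 'q set \<Rightarrow> nat \<Rightarrow> bool" where
  "submanifold_with_corners N K k \<longleftrightarrow>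
    k \<le> coord_dim TYPE('f) \<and> (\<forall>q\<in>K. \<exists>c l A. adapted_chart N K k q c l A)"

text \<open>The cone \<open>T\<^sup>i\<^sub>qK\<close>; the condition does not depend on the adapted chart.\<close>

definition inner_tangent_cone ::
    "('q, 'f::coordinate_space) chart set \<Rightarrow> 'q set \<Rightarrow> nat \<Rightarrow> 'q \<Rightarrow> ('q, 'f) tangent set" where
  "inner_tangent_cone N K k q =
    {v \<in> tangent_space N q. \<exists>c l A. adapted_chart N K k q c l A \<and> v c \<in> model_corner k l A}"

definition polar_cone ::
    "('q, 'f::real_normed_vector) chart set \<Rightarrow> 'q \<Rightarrow> ('q, 'f) tangent set \<Rightarrow>
     (('q, 'f) tangent \<Rightarrow> real) set" where
  "polar_cone N q S = {\<mu> \<in> cotangent_space N q. \<forall>s\<in>S. \<mu> s \<le> 0}"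

section \<open>Local retractions and linearizing maps\<close>

text \<open>
  The tangent space carries the topology and the \<open>C\<^sup>2\<close>-structure of a finite-dimensional vector
  space, given by the linear coordinates \<open>v \<mapsto> v c\<close>. The derivative \<open>DR(0)\<close> is an endomorphism of
  the tangent space at \<open>p\<close>, and its representation in the chart \<open>c\<close> is the derivative at 0 of \<open>R\<close>
  with \<open>c\<close> used on both sides.
\<close>

definition local_retraction ::
    "('p::topological_space, 'e::real_normed_vector) chart set \<Rightarrow> 'p \<Rightarrow>
     ('p, 'e) tangent set \<Rightarrow> (('p, 'e) tangent \<Rightarrow> 'p) \<Rightarrow> bool" where
  "local_retraction M p V R \<longleftrightarrow>
    V \<subseteq> tangent_space M p \<and> tangent_zero \<in> V \<and>
    (\<forall>c\<in>charts_at M p. C2_into M ((\<lambda>v. v c) ` V) (R \<circ> tangent_of M p c)) \<and>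
    R tangent_zero = p \<and>
    (\<forall>c\<in>charts_at M p. frechet_derivative (cmap c \<circ> R \<circ> tangent_of M p c) (at 0) = id)"

definition linearizing_map ::
    "('q::topological_space, 'f::real_normed_vector) chart set \<Rightarrow> 'q \<Rightarrow>
     'q set \<Rightarrow> ('q \<Rightarrow> ('q, 'f) tangent) \<Rightarrow> bool" where
  "linearizing_map N q U S \<longleftrightarrow>
    q \<in> U \<and> S ` U \<subseteq> tangent_space N q \<and>
    (\<forall>c\<in>charts_at N q. C2_fun_on N U (\<lambda>x. S x c)) \<and>
    S q = tangent_zero \<and>
    (\<forall>c\<in>charts_at N q. \<forall>v\<in>tangent_space N q. fun_deriv N (\<lambda>x. S x c) q v = v c)"

text \<open>The domain of an adapted linearizing map is taken so small that the map is injective.\<close>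

definition adapted_linearizing_map ::
    "('q::topological_space, 'f::coordinate_space) chart set \<Rightarrow> 'q set \<Rightarrow> nat \<Rightarrow> 'q \<Rightarrow>
     'q set \<Rightarrow> ('q \<Rightarrow> ('q, 'f) tangent) \<Rightarrow> bool" where
  "adapted_linearizing_map N K k q U S \<longleftrightarrow>
    linearizing_map N q U S \<and> inj_on S U \<and>
    S ` (U \<inter> K) = S ` U \<inter> inner_tangent_cone N K k q"

section \<open>The constrained problem\<close>

definition KKT ::
    "('p, 'e::real_normed_vector) chart set \<Rightarrow> ('q, 'f::coordinate_space) chart set \<Rightarrow>
     'q set \<Rightarrow> nat \<Rightarrow> ('p \<Rightarrow> real) \<Rightarrow> ('p \<Rightarrow> 'q) \<Rightarrow> 'p \<Rightarrow> (('q, 'f) tangent \<Rightarrow> real) \<Rightarrow> bool" where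
  "KKT M N K k f g p \<mu> \<longleftrightarrow>
    (\<forall>v\<in>tangent_space M p. fun_deriv M f p v + \<mu> (tangent_map M N g p v) = 0) \<and>
    \<mu> \<in> polar_cone N (g p) (inner_tangent_cone N K k (g p))"

definition critical_cone ::
    "('p, 'e::real_normed_vector) chart set \<Rightarrow> ('q, 'f::coordinate_space) chart set \<Rightarrow>
     'q set \<Rightarrow> nat \<Rightarrow> ('p \<Rightarrow> real) \<Rightarrow> ('p \<Rightarrow> 'q) \<Rightarrow> 'p \<Rightarrow> ('p, 'e) tangent set" where
  "critical_cone M N K k f g p =
    {v \<in> tangent_space M p.
      tangent_map M N g p v \<in> inner_tangent_cone N K k (g p) \<and> fun_deriv M f p v = 0}"

text \<open>
  The Lagrangian is only meaningful where \<open>g p\<close> lies in the domain of \<open>S\<close>, which is a neighborhood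
  of the point of interest; likewise for its pullback along a retraction.
\<close>

definition lagrangian ::
    "('p \<Rightarrow> real) \<Rightarrow> ('p \<Rightarrow> 'q) \<Rightarrow> ('q \<Rightarrow> ('q, 'f) tangent) \<Rightarrow>
     (('q, 'f) tangent \<Rightarrow> real) \<Rightarrow> 'p \<Rightarrow> real" where
  "lagrangian f g S \<mu> p = f p + \<mu> (S (g p))"

definition pullback_lagrangian ::
    "('p \<Rightarrow> real) \<Rightarrow> ('p \<Rightarrow> 'q) \<Rightarrow> (('p, 'e) tangent \<Rightarrow> 'p) \<Rightarrow> ('q \<Rightarrow> ('q, 'f) tangent) \<Rightarrow>
     (('q, 'f) tangent \<Rightarrow> real) \<Rightarrow> ('p, 'e) tangent \<Rightarrow> real" where
  "pullback_lagrangian f g R S \<mu> v = f (R v) + \<mu> (S (g (R v)))"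

end

theory Submission
  imports Defs
begin

text \<open>
  In coordinates both Lagrangians differ by \<open>\<delta> \<circ> G\<close>, where \<open>G\<close> represents \<open>g\<close> and
  \<open>\<delta> = \<mu> \<circ> (S\<^sub>2 - S\<^sub>1)\<close> is stationary at \<open>q\<^sub>*\<close> because \<open>DS\<^sub>i(q\<^sub>*) = id\<close>. Hence the second
  derivatives in direction \<open>v\<close> differ by \<open>\<delta>''(q\<^sub>*)[w, w]\<close> with \<open>w = g'(p\<^sub>*)v\<close>. For small \<open>t > 0\<close>
  there is a point \<open>y\<^sub>t\<close> with \<open>S\<^sub>1(y\<^sub>t) = tw\<close>; it belongs to \<open>K\<close> since \<open>S\<^sub>1\<close> is adapted and
  injective, so \<open>S\<^sub>2(y\<^sub>t)\<close> lies in the tangent cone, and \<open>\<delta>(y\<^sub>t) = \<mu> S\<^sub>2(y\<^sub>t) - t \<mu>w \<le> 0\<close>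
  because \<open>\<mu>\<close> is in the polar cone and \<open>\<mu>w = -f'(p\<^sub>*)v = 0\<close>. Dividing by \<open>t\<^sup>2\<close> gives
  \<open>\<delta>''(q\<^sub>*)[w, w] \<le> 0\<close>, and exchanging \<open>S\<^sub>1\<close> and \<open>S\<^sub>2\<close> gives equality. The claim on retractions
  is the second-order chain rule at a stationary point.
\<close>

section \<open>Finite-dimensional linear algebra in coordinate spaces\<close>

text \<open>The difference of the two sides is orthogonal to every basis vector, and by the third
  class axiom only 0 is. Spanning is thus derived from orthonormality and a trivial orthogonal
  complement.\<close>

lemma coordinate_expansion:
  fixes x :: "'a::coordinate_space"
  shows "(\<Sum>u\<in>set std_basis. inner x u *\<^sub>R u) = x"
proof -
  have "inner ((\<Sum>u\<in>set std_basis. inner x u *\<^sub>R u) - x) v = 0" if "v \<in> set std_basis" for v :: 'a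
  proof -
    have "(\<Sum>u\<in>set std_basis. inner x u * inner u v) = (\<Sum>u\<in>set std_basis. if u = v then inner x v else 0)"
      using that by (intro sum.cong) (auto simp: inner_std_basis)
    then show ?thesis using that by (simp add: inner_diff_left inner_sum_left)
  qed
  then have "(\<Sum>u\<in>set std_basis. inner x u *\<^sub>R u) - x = 0"
    by (rule std_basis_all_zero_iff[THEN iffD1, OF ballI])
  then show ?thesis by simp
qed

text \<open>By the expansion, \<open>h\<close> is a finite sum of coordinate functionals times the
  fixed vectors \<open>h u\<close>. This makes cotangent vectors, which are only algebraically
  linear, accessible to calculus.\<close>

lemma linear_imp_bounded_linear_coordinate:
  fixes h :: "'a::coordinate_space \<Rightarrow> 'b::real_normed_vector"
  assumes "linear h"
  shows "bounded_linear h"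
proof -
  have *: "h = (\<lambda>x. \<Sum>u\<in>set std_basis. inner x u *\<^sub>R h u)"
  proof
    fix x
    have "h x = h (\<Sum>u\<in>set std_basis. inner x u *\<^sub>R u)" by (simp add: coordinate_expansion)
    then show "h x = (\<Sum>u\<in>set std_basis. inner x u *\<^sub>R h u)"
      using assms by (simp add: linear_sum linear_cmul)
  qed
  show ?thesis
    by (subst *) (intro bounded_linear_sum bounded_linear_scaleR_const bounded_linear_inner_left)
qed

text \<open>Each coordinate converges separately, and there are finitely many. Completeness serves
  Banach's fixed point theorem in \<open>local_preimage\<close>.\<close>

lemma complete_UNIV_coordinate: "complete (UNIV :: 'a::coordinate_space set)"
  unfolding complete_def
proof safe
  fix X :: "nat \<Rightarrow> 'a" assume X: "Cauchy X"
  have "\<exists>l. (\<lambda>n. inner (X n) u) \<longlonglongrightarrow> l" for u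
    using bounded_linear.Cauchy[OF bounded_linear_inner_left X]
    by (simp add: convergent_eq_Cauchy)
  then obtain l where l: "\<And>u. (\<lambda>n. inner (X n) u) \<longlonglongrightarrow> l u" by metis
  have "(\<lambda>n. \<Sum>u\<in>set std_basis. inner (X n) u *\<^sub>R u) \<longlonglongrightarrow> (\<Sum>u\<in>set std_basis. l u *\<^sub>R u)"
    by (intro tendsto_intros l)
  then show "\<exists>l\<in>UNIV. X \<longlonglongrightarrow> l" by (auto simp: coordinate_expansion)
qed

section \<open>Second derivatives at a point and their chain rule\<close>

text \<open>
  \<open>f''\<close> need not exist away from \<open>x\<close>: this pointwise notion is stable under composition without
  any continuity bookkeeping and still suffices for the Taylor estimate below.
\<close>

definition has_second_derivative ::
    "('a::real_normed_vector \<Rightarrow> 'b::real_normed_vector) \<Rightarrow> ('a \<Rightarrow> 'a \<Rightarrow>\<^sub>L 'b) \<Rightarrow>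
     ('a \<Rightarrow> 'a \<Rightarrow>\<^sub>L 'b) \<Rightarrow> 'a \<Rightarrow> bool" where
  "has_second_derivative f f' f'' x \<longleftrightarrow>
    (\<forall>\<^sub>F y in nhds x. (f has_derivative blinfun_apply (f' y)) (at y)) \<and>
    (f' has_derivative f'') (at x)"

lemma has_second_derivativeD:
  assumes "has_second_derivative f f' f'' x"
  shows "\<forall>\<^sub>F y in nhds x. (f has_derivative blinfun_apply (f' y)) (at y)"
    and "(f has_derivative blinfun_apply (f' x)) (at x)"
    and "(f' has_derivative f'') (at x)"
    and "bounded_linear f''"
    and "isCont f x"
proof -
  show ev: "\<forall>\<^sub>F y in nhds x. (f has_derivative blinfun_apply (f' y)) (at y)"
    and 2: "(f' has_derivative f'') (at x)"
    using assms by (simp_all add: has_second_derivative_def)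
  show 1: "(f has_derivative blinfun_apply (f' x)) (at x)"
    using ev by (rule eventually_nhds_x_imp_x)
  show "bounded_linear f''" using 2 by (rule has_derivative_bounded_linear)
  show "isCont f x" using 1 by (rule has_derivative_continuous)
qed

lemma C2_on_imp_has_second_derivative:
  assumes "C2_on X f" "x \<in> X"
  obtains f' f'' where "has_second_derivative f f' f'' x"
proof -
  from assms obtain f' f'' where "open X"
    "\<forall>x\<in>X. (f has_derivative blinfun_apply (f' x)) (at x)"
    "\<forall>x\<in>X. (f' has_derivative blinfun_apply (f'' x)) (at x)"
    unfolding C2_on_def by blast
  with assms(2) have "has_second_derivative f f' (blinfun_apply (f'' x)) x"
    unfolding has_second_derivative_def by (auto simp: eventually_nhds)
  then show ?thesis by (rule that)
qed

lemma C2_on_imp_differentiable: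
  assumes "C2_on X f" "x \<in> X"
  shows "f differentiable (at x)"
  using assms unfolding C2_on_def differentiable_def by blast

lemma has_second_derivative_cong:
  assumes f: "has_second_derivative f f' f'' x" and eq: "\<forall>\<^sub>F y in nhds x. f y = h y"
  shows "has_second_derivative h f' f'' x"
proof -
  \<comment> \<open>The derivative is asserted at all points near \<open>x\<close>, so the two
    functions must agree in a neighborhood of each of these points.\<close>
  have "\<forall>\<^sub>F y in nhds x. \<forall>\<^sub>F z in nhds y. f z = h z"
    using eq by (simp add: eventually_eventually)
  with has_second_derivativeD(1)[OF f]
  have "\<forall>\<^sub>F y in nhds x. (h has_derivative blinfun_apply (f' y)) (at y)"
    by eventually_elim
      (auto intro!: has_derivative_transform_eventually[of f]
        dest: eventually_nhds_x_imp_x simp: eventually_at_filter elim: eventually_mono)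
  with has_second_derivativeD(3)[OF f] show ?thesis by (simp add: has_second_derivative_def)
qed

text \<open>Connects the pointwise notion with the iterated \<open>frechet_derivative\<close>. The
  direction \<open>v\<close> is fixed before the second differentiation, so \<open>f'' w\<close>,
  the change of the derivative in direction \<open>w\<close>, is evaluated at
  \<open>v\<close>.\<close>

lemma second_derivative_eq:
  assumes f: "has_second_derivative f f' f'' x"
  shows "second_derivative f x v w = blinfun_apply (f'' w) v"
proof -
  have ev: "\<forall>\<^sub>F y in nhds x. blinfun_apply (f' y) v = frechet_derivative f (at y) v"
    using has_second_derivativeD(1)[OF f] by eventually_elim (metis frechet_derivative_at)
  have "((\<lambda>y. blinfun_apply (f' y) v) has_derivative (\<lambda>h. blinfun_apply (f'' h) v)) (at x)"
    by (rule bounded_linear.has_derivative[OF blinfun.bounded_linear_left has_second_derivativeD(3)[OF f]])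
  then have "((\<lambda>y. frechet_derivative f (at y) v) has_derivative (\<lambda>h. blinfun_apply (f'' h) v)) (at x)"
    by (rule has_derivative_transform_eventually)
      (use ev in \<open>auto dest: eventually_nhds_x_imp_x simp: eventually_at_filter elim: eventually_mono\<close>)
  then show ?thesis unfolding second_derivative_def
    by (metis frechet_derivative_at)
qed

lemma has_second_derivative_add:
  assumes f: "has_second_derivative f f' f'' x" and h: "has_second_derivative h h' h'' x"
  shows "has_second_derivative (\<lambda>y. f y + h y) (\<lambda>y. f' y + h' y) (\<lambda>v. f'' v + h'' v) x"
proof -
  have "\<forall>\<^sub>F y in nhds x. ((\<lambda>y. f y + h y) has_derivative blinfun_apply (f' y + h' y)) (at y)"
    using has_second_derivativeD(1)[OF f] has_second_derivativeD(1)[OF h]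
    by eventually_elim (auto simp: plus_blinfun.rep_eq intro: has_derivative_add)
  then show ?thesis
    using has_second_derivativeD(3)[OF f] has_second_derivativeD(3)[OF h]
    by (auto simp: has_second_derivative_def intro: has_derivative_add)
qed

lemma has_second_derivative_diff:
  assumes f: "has_second_derivative f f' f'' x" and h: "has_second_derivative h h' h'' x"
  shows "has_second_derivative (\<lambda>y. f y - h y) (\<lambda>y. f' y - h' y) (\<lambda>v. f'' v - h'' v) x"
proof -
  have "\<forall>\<^sub>F y in nhds x. ((\<lambda>y. f y - h y) has_derivative blinfun_apply (f' y - h' y)) (at y)"
    using has_second_derivativeD(1)[OF f] has_second_derivativeD(1)[OF h]
    by eventually_elim (auto simp: minus_blinfun.rep_eq intro: has_derivative_diff)
  then show ?thesis
    using has_second_derivativeD(3)[OF f] has_second_derivativeD(3)[OF h]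
    by (auto simp: has_second_derivative_def intro: has_derivative_diff)
qed

lemma has_second_derivative_linear:
  assumes "bounded_linear h"
  shows "has_second_derivative h (\<lambda>_. Blinfun h) (\<lambda>_. 0) x"
  using assms by (auto simp: has_second_derivative_def bounded_linear_Blinfun_apply
      intro!: always_eventually bounded_linear_imp_has_derivative)

text \<open>The first derivative is the product \<open>f' (h y) o\<^sub>L h' y\<close> of operators.
  Composition of operators is bounded bilinear, and its Leibniz rule gives the two summands.\<close>

lemma has_second_derivative_compose:
  fixes f :: "'b::real_normed_vector \<Rightarrow> 'c::real_normed_vector" and h :: "'a::real_normed_vector \<Rightarrow> 'b"
  assumes f: "has_second_derivative f f' f'' (h x)" and h: "has_second_derivative h h' h'' x"
  shows "has_second_derivative (\<lambda>y. f (h y)) (\<lambda>y. f' (h y) o\<^sub>L h' y)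
    (\<lambda>v. (f' (h x) o\<^sub>L h'' v) + (f'' (blinfun_apply (h' x) v) o\<^sub>L h' x)) x"
proof -
  have "filterlim h (nhds (h x)) (nhds x)"
    using has_second_derivativeD(5)[OF h] by (simp add: isCont_def tendsto_at_iff_tendsto_nhds)
  then have "\<forall>\<^sub>F y in nhds x. (f has_derivative blinfun_apply (f' (h y))) (at (h y))"
    by (rule eventually_compose_filterlim[OF has_second_derivativeD(1)[OF f]])
  with has_second_derivativeD(1)[OF h]
  have "\<forall>\<^sub>F y in nhds x. ((\<lambda>y. f (h y)) has_derivative blinfun_apply (f' (h y) o\<^sub>L h' y)) (at y)"
  proof eventually_elim
    case (elim y)
    have "blinfun_apply (f' (h y) o\<^sub>L h' y) = (\<lambda>v. blinfun_apply (f' (h y)) (blinfun_apply (h' y) v))"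
      by auto
    with has_derivative_compose[OF elim] show ?case by simp
  qed
  moreover have "((\<lambda>y. f' (h y)) has_derivative (\<lambda>v. f'' (blinfun_apply (h' x) v))) (at x)"
    by (rule has_derivative_compose[OF has_second_derivativeD(2)[OF h] has_second_derivativeD(3)[OF f]])
  then have "((\<lambda>y. f' (h y) o\<^sub>L h' y) has_derivative
      (\<lambda>v. (f' (h x) o\<^sub>L h'' v) + (f'' (blinfun_apply (h' x) v) o\<^sub>L h' x))) (at x)"
    by (rule bounded_bilinear.FDERIV[OF bounded_bilinear_blinfun_compose _
          has_second_derivativeD(3)[OF h]])
  ultimately show ?thesis by (simp add: has_second_derivative_def)
qed

text \<open>The summand \<open>f' (h x) o\<^sub>L h'' v\<close> drops out, so \<open>h\<close>
  enters through its first derivative only. This is the invariance of the Hessian at a stationary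
  point under a change of coordinates.\<close>

lemma second_derivative_compose_stationary:
  fixes f :: "'b::real_normed_vector \<Rightarrow> 'c::real_normed_vector" and h :: "'a::real_normed_vector \<Rightarrow> 'b"
  assumes f: "has_second_derivative f f' f'' (h x)" and h: "has_second_derivative h h' h'' x"
    and "f' (h x) = 0"
  shows "second_derivative (\<lambda>y. f (h y)) x v w =
    second_derivative f (h x) (blinfun_apply (h' x) v) (blinfun_apply (h' x) w)"
  unfolding second_derivative_eq[OF has_second_derivative_compose[OF f h]] second_derivative_eq[OF f]
  by (simp add: assms(3) plus_blinfun.rep_eq)

lemma second_derivative_diff:
  assumes f: "has_second_derivative f f' f'' x" and h: "has_second_derivative h h' h'' x"
  shows "second_derivative (\<lambda>y. f y - h y) x v w = second_derivative f x v w - second_derivative h x v w"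
  unfolding second_derivative_eq[OF has_second_derivative_diff[OF f h]]
    second_derivative_eq[OF f] second_derivative_eq[OF h]
  by (simp add: minus_blinfun.rep_eq)

section \<open>Taylor estimate, local solvability and a sign criterion\<close>

text \<open>Mean value inequality along the segment from \<open>x\<close> to \<open>y\<close>, after
  subtracting the quadratic model. The derivative of what remains is small because \<open>f'\<close>
  vanishes at \<open>x\<close> and is differentiable there.\<close>

lemma taylor_second_order:
  fixes f :: "'a::real_normed_vector \<Rightarrow> 'b::real_normed_vector"
  assumes f: "has_second_derivative f f' f'' x" and stat: "f' x = 0" and e: "e > 0"
  shows "\<forall>\<^sub>F y in nhds x. norm (f y - f x - (1/2) *\<^sub>R blinfun_apply (f'' (y - x)) (y - x))
    \<le> e * norm (y - x) ^ 2"
proof -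
  have "\<exists>d>0. \<forall>y. norm (y - x) < d \<longrightarrow> norm (f' y - f' x - f'' (y - x)) \<le> e * norm (y - x)"
    using has_second_derivativeD(3)[OF f] e unfolding has_derivative_at_alt by blast
  then obtain d1 where d1: "d1 > 0"
    "\<And>y. norm (y - x) < d1 \<Longrightarrow> norm (f' y - f'' (y - x)) \<le> e * norm (y - x)"
    using stat by auto
  obtain d2 where d2: "d2 > 0"
    "\<And>y. norm (y - x) < d2 \<Longrightarrow> (f has_derivative blinfun_apply (f' y)) (at y)"
    using has_second_derivativeD(1)[OF f] unfolding eventually_nhds_metric dist_norm by blast
  interpret bounded_linear f'' by (rule has_second_derivativeD(4)[OF f])
  have "norm (f y - f x - (1/2) *\<^sub>R blinfun_apply (f'' (y - x)) (y - x)) \<le> e * norm (y - x) ^ 2"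
    if y: "norm (y - x) < min d1 d2" for y
  proof -
    define h where "h = y - x"
    \<comment> \<open>Chosen so that \<open>q 1 - q 0\<close> is the Taylor remainder.\<close>
    define q where "q t = f (x + t *\<^sub>R h) - (t\<^sup>2/2) *\<^sub>R blinfun_apply (f'' h) h" for t
    have le: "norm (t *\<^sub>R h) \<le> norm h" if "t \<in> {0..1}" for t
      using that by (simp add: mult_left_le_one_le)
    have lt: "norm (x + t *\<^sub>R h - x) < d1" "norm (x + t *\<^sub>R h - x) < d2" if "t \<in> {0..1}" for t
      using le[OF that] y by (auto simp: h_def)
    have "norm (q 1 - q 0) \<le> e * norm h ^ 2 * norm (1 - 0 :: real)"
    proof (rule differentiable_bound[of "{0..1}" q
          "\<lambda>t u. u *\<^sub>R (blinfun_apply (f' (x + t *\<^sub>R h)) h - t *\<^sub>R blinfun_apply (f'' h) h)"])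
      fix t :: real assume t: "t \<in> {0..1}"
      have "((\<lambda>t. f (x + t *\<^sub>R h)) has_derivative
          (\<lambda>u. blinfun_apply (f' (x + t *\<^sub>R h)) (u *\<^sub>R h))) (at t within {0..1})"
        by (rule has_derivative_compose[of "\<lambda>t. x + t *\<^sub>R h" "\<lambda>u. u *\<^sub>R h" t "{0..1}" f])
          (auto intro!: derivative_eq_intros d2(2)[OF lt(2)[OF t]])
      moreover have "((\<lambda>t. (t\<^sup>2/2) *\<^sub>R blinfun_apply (f'' h) h) has_derivative
          (\<lambda>u. (u * t) *\<^sub>R blinfun_apply (f'' h) h)) (at t within {0..1})"
        by (auto intro!: derivative_eq_intros)
      ultimately show "(q has_derivative
          (\<lambda>u. u *\<^sub>R (blinfun_apply (f' (x + t *\<^sub>R h)) h - t *\<^sub>R blinfun_apply (f'' h) h)))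
          (at t within {0..1})"
        unfolding q_def by (auto intro!: derivative_eq_intros simp: blinfun.scaleR_right algebra_simps)
      have "norm (blinfun_apply (f' (x + t *\<^sub>R h)) h - t *\<^sub>R blinfun_apply (f'' h) h)
          = norm (blinfun_apply (f' (x + t *\<^sub>R h) - f'' (t *\<^sub>R h)) h)"
        by (simp add: scaleR minus_blinfun.rep_eq scaleR_blinfun.rep_eq)
      also have "\<dots> \<le> norm (f' (x + t *\<^sub>R h) - f'' (t *\<^sub>R h)) * norm h"
        by (rule norm_blinfun)
      also have "\<dots> \<le> (e * norm (t *\<^sub>R h)) * norm h"
        using d1(2)[OF lt(1)[OF t]] by (intro mult_right_mono) auto
      also have "\<dots> \<le> (e * norm h) * norm h"
        using le[OF t] e by (intro mult_right_mono mult_left_mono) auto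
      finally have *: "norm (blinfun_apply (f' (x + t *\<^sub>R h)) h - t *\<^sub>R blinfun_apply (f'' h) h)
        \<le> e * norm h ^ 2" by (simp add: power2_eq_square mult.assoc)
      show "onorm (\<lambda>u::real. u *\<^sub>R (blinfun_apply (f' (x + t *\<^sub>R h)) h - t *\<^sub>R blinfun_apply (f'' h) h))
        \<le> e * norm h ^ 2"
        using * e by (intro onorm_bound) (auto simp: mult.commute intro!: mult_left_mono)
    qed auto
    then show ?thesis by (simp add: q_def h_def algebra_simps)
  qed
  then show ?thesis
    using d1(1) d2(1) unfolding eventually_nhds_metric dist_norm by (intro exI[of _ "min d1 d2"]) auto
qed

text \<open>
  Replaces the inverse function theorem of the library, which is stated for \<open>euclidean_space\<close>; the
  class \<open>coordinate_space\<close> is not a subclass of it because dimension 0 is allowed.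
\<close>

lemma local_preimage:
  fixes s :: "'a::coordinate_space \<Rightarrow> 'a"
  assumes s: "has_second_derivative s s' s'' z" and id: "s' z = id_blinfun"
  shows "\<forall>\<^sub>F u in nhds 0. \<exists>y. norm (y - z) \<le> 2 * norm u \<and> s y = s z + u"
proof -
  have "isCont s' z" using has_second_derivativeD(3)[OF s] by (rule has_derivative_continuous)
  then obtain d1 where d1: "d1 > 0" "\<And>y. dist y z < d1 \<Longrightarrow> dist (s' y) (s' z) < 1/2"
    unfolding continuous_at_eps_delta by (auto dest: spec[of _ "1/2"])
  obtain d2 where d2: "d2 > 0"
    "\<And>y. dist y z < d2 \<Longrightarrow> (s has_derivative blinfun_apply (s' y)) (at y)"
    using has_second_derivativeD(1)[OF s] unfolding eventually_nhds_metric by blast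
  have "\<exists>y. norm (y - z) \<le> 2 * norm u \<and> s y = s z + u" if u: "norm u < min d1 d2 / 2" for u
  proof -
    \<comment> \<open>The radius fits the contraction factor 1/2: \<open>T\<close> moves the center
      by \<open>u\<close>, and a ball of radius \<open>r\<close> is mapped into itself if
      \<open>r/2 + norm u \<le> r\<close>.\<close>
    define B where "B = cball z (2 * norm u)"
    \<comment> \<open>Its fixed points are the solutions of \<open>s y = s z + u\<close>; its
      derivative \<open>id_blinfun - s' y\<close> has norm at most 1/2 on \<open>B\<close>.\<close>
    define T where "T y = y - s y + s z + u" for y
    have near: "dist y z < d1" "dist y z < d2" if "y \<in> B" for y
      using that u by (auto simp: B_def dist_commute)
    have lip: "norm (T x - T y) \<le> 1/2 * norm (x - y)" if "x \<in> B" "y \<in> B" for x y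
    proof (rule differentiable_bound[of B T "\<lambda>y. blinfun_apply (id_blinfun - s' y)"])
      fix y assume y: "y \<in> B"
      show "(T has_derivative blinfun_apply (id_blinfun - s' y)) (at y within B)"
        unfolding T_def using has_derivative_at_withinI[OF d2(2)[OF near(2)[OF y]], of B]
        by (auto intro!: derivative_eq_intros simp: minus_blinfun.rep_eq)
      show "onorm (blinfun_apply (id_blinfun - s' y)) \<le> 1/2"
        using d1(2)[OF near(1)[OF y]] by (simp add: norm_blinfun.rep_eq[symmetric] dist_norm norm_minus_commute id)
    qed (use that in \<open>auto simp: B_def\<close>)
    have z: "z \<in> B" by (simp add: B_def)
    have "\<exists>!y\<in>B. T y = y"
    proof (rule Banach_fix)
      show "complete B" unfolding B_def
        using complete_closed_subset[OF _ subset_UNIV complete_UNIV_coordinate] by blast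
      show "T ` B \<subseteq> B"
      proof safe
        fix y assume y: "y \<in> B"
        have "T y - z = (T y - T z) + u" by (simp add: T_def)
        then have "norm (T y - z) \<le> norm (T y - T z) + norm u" by (metis norm_triangle_ineq)
        also have "\<dots> \<le> 1/2 * norm (y - z) + norm u" using lip[OF y z] by simp
        also have "\<dots> \<le> 2 * norm u" using y by (simp add: B_def dist_norm norm_minus_commute)
        finally show "T y \<in> B" by (simp add: B_def dist_norm norm_minus_commute)
      qed
      show "dist (T x) (T y) \<le> 1/2 * dist x y" if "x \<in> B" "y \<in> B" for x y
        using lip[OF that] by (simp add: dist_norm)
    qed (use z in auto)
    then obtain y where "y \<in> B" "T y = y" by auto
    then show ?thesis by (intro exI[of _ y]) (auto simp: B_def T_def dist_norm norm_minus_commute algebra_simps)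
  qed
  then show ?thesis
    using d1(1) d2(1) unfolding eventually_nhds_metric
    by (intro exI[of _ "min d1 d2 / 2"]) auto
qed

text \<open>Solving \<open>s y = t *\<^sub>R w\<close> for small \<open>t > 0\<close> gives points
  leaving \<open>z\<close> with velocity \<open>w\<close>. As \<delta> is stationary at
  \<open>z\<close>, its second-order behavior along them depends on this velocity only.\<close>

lemma second_derivative_nonpos:
  fixes s :: "'a::coordinate_space \<Rightarrow> 'a" and \<delta> :: "'a \<Rightarrow> real"
  assumes s: "has_second_derivative s s' s'' z" and s0: "s z = 0" and id: "s' z = id_blinfun"
    and \<delta>: "has_second_derivative \<delta> \<delta>' \<delta>'' z" and \<delta>0: "\<delta> z = 0" and stat: "\<delta>' z = 0"
    and sign: "\<forall>\<^sub>F y in nhds z. \<forall>t>0. s y = t *\<^sub>R w \<longrightarrow> \<delta> y \<le> 0"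
  shows "second_derivative \<delta> z w w \<le> 0"
proof -
  have tw: "((\<lambda>t. t *\<^sub>R w) \<longlongrightarrow> 0) (at_right 0)"
    by (auto intro!: tendsto_eq_intros)
  have "\<forall>\<^sub>F t in at_right 0. \<exists>y. norm (y - z) \<le> 2 * norm (t *\<^sub>R w) \<and> s y = t *\<^sub>R w"
    using eventually_compose_filterlim[OF local_preimage[OF s id] tw] by (simp add: s0)
  \<comment> \<open>Collects the solutions into one function of \<open>t\<close>; its values where
    no solution exists do not matter.\<close>
  then have "\<exists>y. \<forall>\<^sub>F t in at_right 0. norm (y t - z) \<le> 2 * norm (t *\<^sub>R w) \<and> s (y t) = t *\<^sub>R w"
    by (intro exI[of _ "\<lambda>t. SOME y. norm (y - z) \<le> 2 * norm (t *\<^sub>R w) \<and> s y = t *\<^sub>R w"])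
      (erule eventually_mono, erule someI_ex)
  then obtain y where y:
    "\<forall>\<^sub>F t in at_right 0. norm (y t - z) \<le> 2 * norm (t *\<^sub>R w) \<and> s (y t) = t *\<^sub>R w" ..
  have "((\<lambda>t. 2 * norm (t *\<^sub>R w)) \<longlongrightarrow> 0) (at_right 0)"
    using tendsto_mult[OF tendsto_const tendsto_norm_zero[OF tw], of 2] by simp
  then have "((\<lambda>t. y t - z) \<longlongrightarrow> 0) (at_right 0)"
    by (rule Lim_null_comparison[rotated]) (use y in \<open>auto elim: eventually_mono\<close>)
  then have yz: "(y \<longlongrightarrow> z) (at_right 0)" by (simp add: LIM_zero_iff)
  have pos: "\<forall>\<^sub>F t in at_right 0. t > (0::real)" by (rule eventually_at_right_less)
  \<comment> \<open>The difference quotient of the solutions. It tends to \<open>w\<close> because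
    \<open>s y\<close> agrees with \<open>y - z\<close> to first order.\<close>
  define H where "H t = (1 / t) *\<^sub>R (y t - z)" for t
  have H: "(H \<longlongrightarrow> w) (at_right 0)"
  proof (rule tendstoI)
    fix \<epsilon> :: real assume \<epsilon>: "\<epsilon> > 0"
    \<comment> \<open>The 2 matches the bound on \<open>norm (y t - z)\<close>; the added 1 covers
      \<open>w = 0\<close>.\<close>
    define e where "e = \<epsilon> / (2 * norm w + 1)"
    have e: "e > 0" "2 * e * norm w < \<epsilon>"
      using \<epsilon> by (auto simp: e_def field_simps add_pos_nonneg)
    have "\<exists>d>0. \<forall>y. norm (y - z) < d \<longrightarrow> norm (s y - s z - (y - z)) \<le> e * norm (y - z)"
      using has_second_derivativeD(2)[OF s] e(1) unfolding id has_derivative_at_alt by simp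
    then have "\<forall>\<^sub>F y in nhds z. norm (s y - (y - z)) \<le> e * norm (y - z)"
      by (auto simp: eventually_nhds_metric dist_norm s0)
    then have "\<forall>\<^sub>F t in at_right 0. norm (s (y t) - (y t - z)) \<le> e * norm (y t - z)"
      using yz by (rule eventually_compose_filterlim)
    with y pos show "\<forall>\<^sub>F t in at_right 0. dist (H t) w < \<epsilon>"
    proof eventually_elim
      case (elim t)
      have "t * dist (H t) w = norm (t *\<^sub>R (w - H t))"
        using elim by (simp add: dist_norm norm_minus_commute)
      also have "t *\<^sub>R (w - H t) = s (y t) - (y t - z)"
        using elim by (simp add: H_def algebra_simps)
      also have "norm \<dots> \<le> e * norm (y t - z)" using elim by simp
      also have "\<dots> \<le> e * (2 * norm (t *\<^sub>R w))" using elim e(1) by (intro mult_left_mono) auto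
      also have "\<dots> = t * (2 * e * norm w)" using elim by simp
      finally have "dist (H t) w \<le> 2 * e * norm w" using elim by simp
      with e show ?case by simp
    qed
  qed
  interpret bounded_linear \<delta>'' by (rule has_second_derivativeD(4)[OF \<delta>])
  have lim: "((\<lambda>t. blinfun_apply (\<delta>'' (H t)) (H t)) \<longlongrightarrow> blinfun_apply (\<delta>'' w) w) (at_right 0)"
    by (intro blinfun.tendsto tendsto H)
  have "blinfun_apply (\<delta>'' w) w \<le> 0 + \<epsilon>" if \<epsilon>: "\<epsilon> > 0" for \<epsilon>
  proof -
    \<comment> \<open>Here 8 = 2 * 4: the 2 clears the 1/2 of the Taylor formula, the 4 is the
      square of the 2 in the bound on \<open>norm (y t - z)\<close>.\<close>
    define e where "e = \<epsilon> / (8 * (norm w ^ 2 + 1))"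
    have e: "e > 0" "8 * e * norm w ^ 2 \<le> \<epsilon>"
      using \<epsilon> by (auto simp: e_def field_simps add_pos_nonneg)
    have "\<forall>\<^sub>F t in at_right 0. \<forall>u>0. s (y t) = u *\<^sub>R w \<longrightarrow> \<delta> (y t) \<le> 0"
      using sign yz by (rule eventually_compose_filterlim)
    moreover have "\<forall>\<^sub>F t in at_right 0.
        norm (\<delta> (y t) - \<delta> z - (1/2) *\<^sub>R blinfun_apply (\<delta>'' (y t - z)) (y t - z)) \<le> e * norm (y t - z) ^ 2"
      using taylor_second_order[OF \<delta> stat e(1)] yz by (rule eventually_compose_filterlim)
    ultimately have "\<forall>\<^sub>F t in at_right 0. blinfun_apply (\<delta>'' (H t)) (H t) \<le> \<epsilon>"
      using y pos
    proof eventually_elim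
      case (elim t)
      have "y t - z = t *\<^sub>R H t" using elim by (simp add: H_def)
      then have "blinfun_apply (\<delta>'' (y t - z)) (y t - z) = t\<^sup>2 * blinfun_apply (\<delta>'' (H t)) (H t)"
        by (simp add: scaleR scaleR_blinfun.rep_eq blinfun.scaleR_right power2_eq_square)
      then have "t\<^sup>2 * blinfun_apply (\<delta>'' (H t)) (H t) \<le> 2 * \<delta> (y t) + 2 * (e * norm (y t - z) ^ 2)"
        using elim by (simp add: \<delta>0 abs_le_iff)
      also have "\<dots> \<le> 2 * (e * norm (y t - z) ^ 2)" using elim by simp
      also have "norm (y t - z) ^ 2 \<le> (2 * norm (t *\<^sub>R w)) ^ 2"
        using elim by (intro power_mono) auto
      finally have "t\<^sup>2 * blinfun_apply (\<delta>'' (H t)) (H t) \<le> t\<^sup>2 * (8 * e * norm w ^ 2)"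
        using e(1) by (simp add: power_mult_distrib mult_ac)
      then show ?case using elim e(2) by simp
    qed
    then show ?thesis using tendsto_upperbound[OF lim] by simp
  qed
  then have "blinfun_apply (\<delta>'' w) w \<le> 0" by (rule field_le_epsilon)
  then show ?thesis by (simp add: second_derivative_eq[OF \<delta>])
qed

section \<open>Charts, tangent vectors and cotangent vectors\<close>

lemma topological_chartD:
  assumes "topological_chart c"
  shows "open (cdom c)" and "open (cmap c ` cdom c)"
    and "x \<in> cdom c \<Longrightarrow> cinv c (cmap c x) = x"
    and "y \<in> cmap c ` cdom c \<Longrightarrow> cmap c (cinv c y) = y"
    and "continuous_on (cmap c ` cdom c) (cinv c)"
proof -
  have hom: "open (cdom c)" "open (cmap c ` cdom c)"
    "homeomorphism (cdom c) (cmap c ` cdom c) (cmap c) (cinv c)"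
    using assms by (simp_all add: topological_chart_def)
  show "open (cdom c)" "open (cmap c ` cdom c)" by (fact hom)+
  show "cinv c (cmap c x) = x" if "x \<in> cdom c" using homeomorphism_apply1[OF hom(3) that] .
  show "cmap c (cinv c y) = y" if "y \<in> cmap c ` cdom c" using homeomorphism_apply2[OF hom(3) that] .
  show "continuous_on (cmap c ` cdom c) (cinv c)" using homeomorphism_cont2[OF hom(3)] .
qed

lemma charts_atD:
  assumes "C2_manifold M" "c \<in> charts_at M p"
  shows "topological_chart c" and "c \<in> M" and "p \<in> cdom c" and "cinv c (cmap c p) = p"
  using assms topological_chartD(3) unfolding C2_manifold_def charts_at_def by blast+

lemma some_chart_in_charts_at:
  assumes "C2_manifold M"
  shows "some_chart M p \<in> charts_at M p"
proof -
  have "p \<in> (\<Union>c\<in>M. cdom c)" using assms by (simp add: C2_manifold_def)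
  then have "\<exists>c. c \<in> charts_at M p" by (auto simp: charts_at_def)
  then show ?thesis unfolding some_chart_def by (rule someI_ex)
qed

lemma filterlim_cinv:
  assumes "C2_manifold M" "c \<in> charts_at M p"
  shows "filterlim (cinv c) (nhds p) (nhds (cmap c p))"
proof -
  note c = charts_atD[OF assms]
  have "isCont (cinv c) (cmap c p)"
    using topological_chartD(2,5)[OF c(1)] c(3) continuous_on_eq_continuous_at by blast
  then have "filterlim (cinv c) (nhds (cinv c (cmap c p))) (nhds (cmap c p))"
    by (simp only: isCont_def tendsto_at_iff_tendsto_nhds)
  then show ?thesis by (simp add: c(4))
qed

lemma chart_transition_differentiable:
  assumes "C2_manifold M" "c \<in> charts_at M p" "d \<in> charts_at M p"
  shows "(cmap d \<circ> cinv c) differentiable (at (cmap c p))"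
proof (rule C2_on_imp_differentiable)
  show "C2_on (cmap c ` (cdom c \<inter> cdom d)) (cmap d \<circ> cinv c)"
    using assms unfolding C2_manifold_def charts_at_def C2_compatible_def by blast
  show "cmap c p \<in> cmap c ` (cdom c \<inter> cdom d)"
    using assms by (auto simp: charts_at_def)
qed

text \<open>Near \<open>x\<close> the map \<open>h \<circ> \<psi>\<close> factors through the chart
  \<open>d\<close>, since continuity of \<psi> at \<open>x\<close> keeps its values in
  \<open>cdom d\<close>. Used with an inverse chart for \<psi> and with
  \<open>g \<circ> cinv c\<close>.\<close>

lemma frechet_derivative_via_chart:
  assumes N: "C2_manifold N" and d: "d \<in> charts_at N (\<psi> x)"
    and \<psi>: "filterlim \<psi> (nhds (\<psi> x)) (nhds x)" and "(cmap d \<circ> \<psi>) differentiable (at x)"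
    and "(h \<circ> cinv d) differentiable (at (cmap d (\<psi> x)))"
  shows "frechet_derivative (h \<circ> \<psi>) (at x) v =
    frechet_derivative (h \<circ> cinv d) (at (cmap d (\<psi> x))) (frechet_derivative (cmap d \<circ> \<psi>) (at x) v)"
proof -
  note d' = charts_atD[OF N d]
  have "\<forall>\<^sub>F y in nhds x. \<psi> y \<in> cdom d"
    using eventually_nhds_in_open[OF topological_chartD(1)[OF d'(1)] d'(3)] \<psi>
    by (rule eventually_compose_filterlim)
  then obtain X where X: "open X" "x \<in> X" "\<And>y. y \<in> X \<Longrightarrow> \<psi> y \<in> cdom d"
    unfolding eventually_nhds by blast
  have eq: "frechet_derivative ((h \<circ> cinv d) \<circ> (cmap d \<circ> \<psi>)) (at x) = frechet_derivative (h \<circ> \<psi>) (at x)"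
  proof (rule frechet_derivative_transform_within_open[OF _ X(1,2)])
    show "((h \<circ> cinv d) \<circ> (cmap d \<circ> \<psi>)) differentiable (at x)"
      using assms by (intro differentiable_chain_at) auto
  qed (use X(3) topological_chartD(3)[OF d'(1)] in auto)
  have "frechet_derivative ((h \<circ> cinv d) \<circ> (cmap d \<circ> \<psi>)) (at x) =
      frechet_derivative (h \<circ> cinv d) (at (cmap d (\<psi> x))) \<circ> frechet_derivative (cmap d \<circ> \<psi>) (at x)"
    using frechet_derivative_compose[of "cmap d \<circ> \<psi>" x "h \<circ> cinv d"] assms(4,5) by simp
  then show ?thesis by (simp only: comp_apply flip: eq)
qed

text \<open>The transition map from \<open>c\<close> to itself is the identity on the open image of
  \<open>c\<close>.\<close>

lemma tangent_of_apply:
  assumes M: "C2_manifold M" and c: "c \<in> charts_at M p"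
  shows "tangent_of M p c x c = x"
proof -
  note c' = charts_atD[OF M c]
  have "frechet_derivative (\<lambda>x. x) (at (cmap c p)) = frechet_derivative (cmap c \<circ> cinv c) (at (cmap c p))"
    by (rule frechet_derivative_transform_within_open[OF _ topological_chartD(2)[OF c'(1)]])
      (use topological_chartD(4)[OF c'(1)] c'(3) in auto)
  then show ?thesis using c by (simp add: tangent_of_def flip: \<open>frechet_derivative (\<lambda>x. x) _ = _\<close>)
qed

text \<open>Compatibility of the representatives in \<open>d\<close> and \<open>e\<close> is the
  cocycle identity for derivatives of transition maps, that is, the chain rule through
  \<open>d\<close>.\<close>

lemma tangent_of_in_tangent_space:
  assumes M: "C2_manifold M" and c: "c \<in> charts_at M p"
  shows "tangent_of M p c x \<in> tangent_space M p"
proof -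
  have chain: "frechet_derivative (cmap e \<circ> cinv c) (at (cmap c p)) x =
      frechet_derivative (cmap e \<circ> cinv d) (at (cmap d p))
        (frechet_derivative (cmap d \<circ> cinv c) (at (cmap c p)) x)"
    if "d \<in> charts_at M p" "e \<in> charts_at M p" for d e
    using frechet_derivative_via_chart[OF M, of d "cinv c" "cmap c p" "cmap e" x]
      chart_transition_differentiable[OF M c that(1)] chart_transition_differentiable[OF M that]
      filterlim_cinv[OF M c] that
    by (simp add: charts_atD(4)[OF M c])
  show ?thesis
    unfolding tangent_space_def
  proof (intro CollectI conjI allI ballI impI)
    fix d e assume de: "d \<in> charts_at M p" "e \<in> charts_at M p"
    then show "tangent_of M p c x e =
        frechet_derivative (cmap e \<circ> cinv d) (at (cmap d p)) (tangent_of M p c x d)"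
      unfolding tangent_of_def if_P[OF de(1)] if_P[OF de(2)] by (rule chain)
  qed (simp add: tangent_of_def)
qed

lemma tangent_of_representative:
  assumes "v \<in> tangent_space M p" "c \<in> charts_at M p"
  shows "tangent_of M p c (v c) = v"
proof
  fix d
  show "tangent_of M p c (v c) d = v d"
  proof (cases "d \<in> charts_at M p")
    case True
    with assms have "v d = frechet_derivative (cmap d \<circ> cinv c) (at (cmap c p)) (v c)"
      unfolding tangent_space_def by blast
    with True show ?thesis by (simp only: tangent_of_def if_True)
  next
    case False
    have "v d = 0" using assms(1) False unfolding tangent_space_def by blast
    with False show ?thesis by (simp add: tangent_of_def)
  qed
qed

lemma tangent_of_linear:
  assumes M: "C2_manifold M" and c: "c \<in> charts_at M p"
  shows "tangent_of M p c (x + y) = (\<lambda>d. tangent_of M p c x d + tangent_of M p c y d)"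
    and "tangent_of M p c (r *\<^sub>R x) = (\<lambda>d. r *\<^sub>R tangent_of M p c x d)"
    and "tangent_of M p c 0 = tangent_zero"
proof -
  have lin: "linear (frechet_derivative (cmap d \<circ> cinv c) (at (cmap c p)))" if "d \<in> charts_at M p" for d
    using linear_frechet_derivative[OF chart_transition_differentiable[OF M c that]] .
  show "tangent_of M p c (x + y) = (\<lambda>d. tangent_of M p c x d + tangent_of M p c y d)"
    unfolding tangent_of_def by (rule ext) (simp add: linear_add[OF lin])
  show "tangent_of M p c (r *\<^sub>R x) = (\<lambda>d. r *\<^sub>R tangent_of M p c x d)"
    unfolding tangent_of_def by (rule ext) (simp add: linear_cmul[OF lin])
  show "tangent_of M p c 0 = tangent_zero"
    unfolding tangent_of_def tangent_zero_def by (rule ext) (simp add: linear_0[OF lin])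
qed

text \<open>Turns \<mu> into a functional on the model space, to which the rules for second
  derivatives apply.\<close>

lemma bounded_linear_cotangent:
  fixes N :: "('q::{t2_space, second_countable_topology}, 'f::coordinate_space) chart set"
  assumes N: "C2_manifold N" and d: "d \<in> charts_at N q" and \<mu>: "\<mu> \<in> cotangent_space N q"
  shows "bounded_linear (\<lambda>x. \<mu> (tangent_of N q d x))"
proof (rule linear_imp_bounded_linear_coordinate, rule linearI)
  show "\<mu> (tangent_of N q d (x + y)) = \<mu> (tangent_of N q d x) + \<mu> (tangent_of N q d y)" for x y
    using \<mu> tangent_of_in_tangent_space[OF N d]
    by (simp add: cotangent_space_def tangent_of_linear(1)[OF N d])
  show "\<mu> (tangent_of N q d (r *\<^sub>R x)) = r *\<^sub>R \<mu> (tangent_of N q d x)" for r x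
    using \<mu> tangent_of_in_tangent_space[OF N d]
    by (simp add: cotangent_space_def tangent_of_linear(2)[OF N d])
qed

text \<open>The adapted chart that witnesses membership is kept: representatives in it scale
  linearly, and the conditions defining the corner are homogeneous.\<close>

lemma inner_tangent_cone_scale:
  assumes N: "C2_manifold N" and d: "d \<in> charts_at N q"
    and x: "tangent_of N q d x \<in> inner_tangent_cone N K k q" and "t \<ge> 0"
  shows "tangent_of N q d (t *\<^sub>R x) \<in> inner_tangent_cone N K k q"
proof -
  have row: "corner_row k A i (t *\<^sub>R y) = t * corner_row k A i y" for A i and y :: 'b
    unfolding corner_row_def coord_def sum_distrib_left
    by (intro sum.cong) (simp_all only: inner_scaleR_left mult.left_commute)
  have scale: "t *\<^sub>R y \<in> model_corner k l A" if y: "y \<in> model_corner k l A" for y :: 'b and l A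
    unfolding model_corner_def
  proof (intro CollectI conjI allI impI)
    show "W_zero k (t *\<^sub>R y)"
      using y by (simp add: model_corner_def W_zero_def coord_def)
    show "corner_row k A i (t *\<^sub>R y) \<le> 0" if "i < l" for i
      unfolding row using y that \<open>t \<ge> 0\<close> by (intro mult_nonneg_nonpos) (auto simp: model_corner_def)
  qed
  from x obtain c l A where c: "adapted_chart N K k q c l A" "tangent_of N q d x c \<in> model_corner k l A"
    unfolding inner_tangent_cone_def by blast
  from scale[OF c(2)] have "tangent_of N q d (t *\<^sub>R x) c \<in> model_corner k l A"
    by (simp only: tangent_of_linear(2)[OF N d])
  with c(1) tangent_of_in_tangent_space[OF N d] show ?thesis
    unfolding inner_tangent_cone_def by blast
qed

section \<open>Maps between manifolds and linearizing maps in charts\<close>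

lemma C2_map_local:
  assumes M: "C2_manifold M" and N: "C2_manifold N" and g: "C2_map M N g"
    and c: "c \<in> charts_at M p" and d: "d \<in> charts_at N (g p)"
  obtains G' G'' where "has_second_derivative (cmap d \<circ> g \<circ> cinv c) G' G'' (cmap c p)"
    and "filterlim (g \<circ> cinv c) (nhds (g p)) (nhds (cmap c p))"
proof -
  note c' = charts_atD[OF M c]
  have into: "C2_into N (cmap c ` cdom c) (g \<circ> cinv c)"
    using g c'(2) by (simp add: C2_map_def)
  have "isCont (g \<circ> cinv c) (cmap c p)"
    using into c'(3) continuous_on_eq_continuous_at unfolding C2_into_def by blast
  then have "filterlim (g \<circ> cinv c) (nhds ((g \<circ> cinv c) (cmap c p))) (nhds (cmap c p))"
    by (simp only: isCont_def tendsto_at_iff_tendsto_nhds)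
  then have lim: "filterlim (g \<circ> cinv c) (nhds (g p)) (nhds (cmap c p))"
    by (simp add: c'(4))
  have "C2_on (cmap c ` cdom c \<inter> (g \<circ> cinv c) -` cdom d) (cmap d \<circ> (g \<circ> cinv c))"
    using into charts_atD(2)[OF N d] by (simp add: C2_into_def)
  moreover have "cmap c p \<in> cmap c ` cdom c \<inter> (g \<circ> cinv c) -` cdom d"
    using c' charts_atD(3)[OF N d] by auto
  ultimately obtain G' G'' where "has_second_derivative (cmap d \<circ> (g \<circ> cinv c)) G' G'' (cmap c p)"
    by (rule C2_on_imp_has_second_derivative)
  then show ?thesis using lim that by (simp add: o_assoc)
qed

text \<open>The image vector is defined through all charts at \<open>g p\<close>; the chain rule
  through \<open>d\<close> shows that its representative in \<open>d\<close> determines the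
  others.\<close>

lemma tangent_map_eq_tangent_of:
  assumes M: "C2_manifold M" and N: "C2_manifold N" and g: "C2_map M N g"
    and d: "d \<in> charts_at N (g p)"
  defines "c \<equiv> some_chart M p"
  shows "tangent_map M N g p v =
    tangent_of N (g p) d (frechet_derivative (cmap d \<circ> g \<circ> cinv c) (at (cmap c p)) (v c))"
proof
  fix e
  have c: "c \<in> charts_at M p" unfolding c_def by (rule some_chart_in_charts_at[OF M])
  have gp: "g (cinv c (cmap c p)) = g p" by (simp add: charts_atD(4)[OF M c])
  obtain G' G'' where G: "has_second_derivative (cmap d \<circ> g \<circ> cinv c) G' G'' (cmap c p)"
    and lim: "filterlim (g \<circ> cinv c) (nhds (g p)) (nhds (cmap c p))"
    using C2_map_local[OF M N g c d] .
  have "(cmap d \<circ> g \<circ> cinv c) differentiable (at (cmap c p))"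
    using has_second_derivativeD(2)[OF G] by (auto simp: differentiable_def)
  then have "frechet_derivative (cmap e \<circ> (g \<circ> cinv c)) (at (cmap c p)) (v c) =
      frechet_derivative (cmap e \<circ> cinv d) (at (cmap d (g p)))
        (frechet_derivative (cmap d \<circ> (g \<circ> cinv c)) (at (cmap c p)) (v c))"
    if "e \<in> charts_at N (g p)"
    using frechet_derivative_via_chart[OF N, of d "g \<circ> cinv c" "cmap c p" "cmap e" "v c"]
      chart_transition_differentiable[OF N d that] lim d by (simp add: gp o_assoc)
  then show "tangent_map M N g p v e =
      tangent_of N (g p) d (frechet_derivative (cmap d \<circ> g \<circ> cinv c) (at (cmap c p)) (v c)) e"
    by (simp add: tangent_map_def tangent_of_def fun_deriv_def c_def Let_def o_assoc)
qed

text \<open>As \<open>d\<close> is the chart that \<open>fun_deriv\<close> selects at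
  \<open>q\<close>, the condition \<open>DS(q) = id\<close>, tested on the vectors
  \<open>tangent_of N q d x\<close>, is directly a statement about the coordinate form of
  \<open>S\<close>.\<close>

lemma linearizing_map_local:
  assumes N: "C2_manifold N" and S: "linearizing_map N q U S"
  defines "d \<equiv> some_chart N q"
  obtains s' s'' where "has_second_derivative ((\<lambda>x. S x d) \<circ> cinv d) s' s'' (cmap d q)"
    and "s' (cmap d q) = id_blinfun" and "S q = tangent_zero"
proof -
  have d: "d \<in> charts_at N q" unfolding d_def by (rule some_chart_in_charts_at[OF N])
  note d' = charts_atD[OF N d]
  have U: "q \<in> U" "C2_fun_on N U (\<lambda>x. S x d)" "S q = tangent_zero"
    "\<And>v. v \<in> tangent_space N q \<Longrightarrow> fun_deriv N (\<lambda>x. S x d) q v = v d"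
    using S d unfolding linearizing_map_def by blast+
  have "C2_on (cmap d ` (cdom d \<inter> U)) ((\<lambda>x. S x d) \<circ> cinv d)"
    using U(2) d'(2) by (auto simp: C2_fun_on_def)
  moreover have "cmap d q \<in> cmap d ` (cdom d \<inter> U)" using d'(3) U(1) by auto
  ultimately obtain s' s'' where s: "has_second_derivative ((\<lambda>x. S x d) \<circ> cinv d) s' s'' (cmap d q)"
    using C2_on_imp_has_second_derivative by metis
  have "blinfun_apply (s' (cmap d q)) x = x" for x
  proof -
    have "blinfun_apply (s' (cmap d q)) = frechet_derivative ((\<lambda>x. S x d) \<circ> cinv d) (at (cmap d q))"
      using has_second_derivativeD(2)[OF s] by (rule frechet_derivative_at)
    then show ?thesis
      using U(4)[OF tangent_of_in_tangent_space[OF N d]]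
      by (simp add: fun_deriv_def tangent_of_apply[OF N d] flip: d_def)
  qed
  then have "s' (cmap d q) = id_blinfun" by (auto intro: blinfun_eqI)
  from that[OF s this U(3)] show ?thesis .
qed

text \<open>Allows \<open>S x\<close> to be replaced near \<open>q\<close> by its representative
  \<open>S x d\<close>, so that only maps between model spaces are differentiated.\<close>

lemma linearizing_map_near:
  assumes N: "C2_manifold N" and S: "linearizing_map N q U S" and d: "d \<in> charts_at N q"
  shows "\<forall>\<^sub>F x in nhds q. x \<in> U \<inter> cdom d \<and> S x = tangent_of N q d (S x d) \<and> cinv d (cmap d x) = x"
proof -
  have "q \<in> U" "open U" "S ` U \<subseteq> tangent_space N q"
    using S charts_atD(2)[OF N d] d unfolding linearizing_map_def C2_fun_on_def by blast+
  moreover have "open (cdom d)" "q \<in> cdom d"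
    using topological_chartD(1)[OF charts_atD(1)[OF N d]] charts_atD(3)[OF N d] by simp_all
  ultimately have "\<forall>\<^sub>F x in nhds q. x \<in> U \<and> x \<in> cdom d"
    by (intro eventually_conj eventually_nhds_in_open)
  then show ?thesis
  proof eventually_elim
    case (elim x)
    then have "S x \<in> tangent_space N q" using \<open>S ` U \<subseteq> _\<close> by blast
    from tangent_of_representative[OF this d] topological_chartD(3)[OF charts_atD(1)[OF N d]] elim
    show ?case by simp
  qed
qed

section \<open>Comparison of two adapted linearizing maps\<close>

text \<open>The roles are asymmetric: \<open>S1\<close> yields points of \<open>K\<close> above the
  ray through \<open>w\<close>, and \<open>S2\<close> sends them into the cone, where \<mu> is
  nonpositive.\<close>

lemma adapted_linearizing_map_difference_nonpos:
  assumes N: "C2_manifold N"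
    and S1: "adapted_linearizing_map N K k q U1 S1" and S2: "adapted_linearizing_map N K k q U2 S2"
    and \<mu>: "\<mu> \<in> polar_cone N q (inner_tangent_cone N K k q)"
  defines "d \<equiv> some_chart N q"
  assumes w: "tangent_of N q d w \<in> inner_tangent_cone N K k q" "\<mu> (tangent_of N q d w) = 0"
  shows "second_derivative
    (\<lambda>y. \<mu> (tangent_of N q d (S2 (cinv d y) d)) - \<mu> (tangent_of N q d (S1 (cinv d y) d)))
    (cmap d q) w w \<le> 0"
proof -
  have d: "d \<in> charts_at N q" unfolding d_def by (rule some_chart_in_charts_at[OF N])
  note d' = charts_atD[OF N d]
  have lin: "linearizing_map N q U1 S1" "linearizing_map N q U2 S2"
    using S1 S2 by (auto simp: adapted_linearizing_map_def)
  define m where "m x = \<mu> (tangent_of N q d x)" for x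
  have m: "bounded_linear m"
    unfolding m_def using \<mu> by (intro bounded_linear_cotangent[OF N d]) (simp add: polar_cone_def)
  obtain s1' s1'' where s1: "has_second_derivative ((\<lambda>x. S1 x d) \<circ> cinv d) s1' s1'' (cmap d q)"
    and id1: "s1' (cmap d q) = id_blinfun" and S1q: "S1 q = tangent_zero"
    using linearizing_map_local[OF N lin(1)] unfolding d_def by metis
  obtain s2' s2'' where s2: "has_second_derivative ((\<lambda>x. S2 x d) \<circ> cinv d) s2' s2'' (cmap d q)"
    and id2: "s2' (cmap d q) = id_blinfun" and S2q: "S2 q = tangent_zero"
    using linearizing_map_local[OF N lin(2)] unfolding d_def by metis
  note m1 = has_second_derivative_compose[OF has_second_derivative_linear[OF m] s1]
  note m2 = has_second_derivative_compose[OF has_second_derivative_linear[OF m] s2]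
  have "\<forall>\<^sub>F y in nhds (cmap d q). \<forall>t>0. ((\<lambda>x. S1 x d) \<circ> cinv d) y = t *\<^sub>R w \<longrightarrow>
      m (((\<lambda>x. S2 x d) \<circ> cinv d) y) - m (((\<lambda>x. S1 x d) \<circ> cinv d) y) \<le> 0"
    using eventually_compose_filterlim[OF linearizing_map_near[OF N lin(1) d] filterlim_cinv[OF N d]]
      eventually_compose_filterlim[OF linearizing_map_near[OF N lin(2) d] filterlim_cinv[OF N d]]
  proof eventually_elim
    case (elim y)
    show ?case
    proof (intro allI impI)
      fix t :: real assume t: "t > 0" "((\<lambda>x. S1 x d) \<circ> cinv d) y = t *\<^sub>R w"
      have "S1 (cinv d y) \<in> inner_tangent_cone N K k q"
        using elim(1) t inner_tangent_cone_scale[OF N d w(1), of t] by simp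
      then have "S1 (cinv d y) \<in> S1 ` (U1 \<inter> K)"
        using S1 elim(1) unfolding adapted_linearizing_map_def by blast
      \<comment> \<open>Adaptedness provides some point of \<open>U1 \<inter> K\<close> with the
        same image; injectivity on \<open>U1\<close> identifies it with
        \<open>cinv d y\<close>.\<close>
      then have "cinv d y \<in> K"
        using S1 elim(1) unfolding adapted_linearizing_map_def inj_on_def by blast
      then have "S2 (cinv d y) \<in> inner_tangent_cone N K k q"
        using S2 elim(2) unfolding adapted_linearizing_map_def by blast
      then have "m (S2 (cinv d y) d) \<le> 0"
        using \<mu> elim(2) by (auto simp: m_def polar_cone_def)
      moreover have "m (S1 (cinv d y) d) = 0"
        using t(2) w(2) linear_cmul[OF bounded_linear.linear[OF m], of t w] by (simp add: m_def)
      ultimately show "m (((\<lambda>x. S2 x d) \<circ> cinv d) y) - m (((\<lambda>x. S1 x d) \<circ> cinv d) y) \<le> 0"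
        by simp
    qed
  qed
  \<comment> \<open>At the base point both terms vanish and have derivative \<open>m\<close>, since
    each linearizing map vanishes there with identity derivative. Hence their difference is
    stationary.\<close>
  from second_derivative_nonpos[OF s1 _ id1 has_second_derivative_diff[OF m2 m1] _ _ this]
  show ?thesis
    by (simp add: m_def id1 id2 S1q S2q d'(4) tangent_zero_def)
qed

section \<open>The Lagrangian in coordinates and its second derivative\<close>

text \<open>Since \<open>DS(g p) = id\<close>, the derivative of the Lagrangian is the left side of
  the first KKT equation in coordinates. The eventual equation isolates the term through which
  \<open>S\<close> enters.\<close>

lemma lagrangian_local:
  assumes M: "C2_manifold M" and N: "C2_manifold N"
    and f: "C2_fun_on M UNIV f" and g: "C2_map M N g"
    and kkt: "KKT M N K k f g p \<mu>" and S: "linearizing_map N (g p) U S"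
  defines "c \<equiv> some_chart M p" and "d \<equiv> some_chart N (g p)"
  obtains \<Lambda>' \<Lambda>'' where "has_second_derivative (lagrangian f g S \<mu> \<circ> cinv c) \<Lambda>' \<Lambda>'' (cmap c p)"
    and "\<Lambda>' (cmap c p) = 0"
    and "\<forall>\<^sub>F y in nhds (cmap c p). (lagrangian f g S \<mu> \<circ> cinv c) y = (f \<circ> cinv c) y +
      \<mu> (tangent_of N (g p) d (S (cinv d ((cmap d \<circ> g \<circ> cinv c) y)) d))"
proof -
  have c: "c \<in> charts_at M p" unfolding c_def by (rule some_chart_in_charts_at[OF M])
  have d: "d \<in> charts_at N (g p)" unfolding d_def by (rule some_chart_in_charts_at[OF N])
  note c' = charts_atD[OF M c]
  define m where "m x = \<mu> (tangent_of N (g p) d x)" for x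
  have m: "bounded_linear m"
    unfolding m_def using kkt by (intro bounded_linear_cotangent[OF N d]) (simp add: KKT_def polar_cone_def)
  have "C2_on (cmap c ` (cdom c \<inter> UNIV)) (f \<circ> cinv c)"
    using f c'(2) by (auto simp: C2_fun_on_def)
  then obtain f' f'' where f': "has_second_derivative (f \<circ> cinv c) f' f'' (cmap c p)"
    by (rule C2_on_imp_has_second_derivative) (use c'(3) in auto)
  obtain G' G'' where G: "has_second_derivative (cmap d \<circ> g \<circ> cinv c) G' G'' (cmap c p)"
    and lim: "filterlim (g \<circ> cinv c) (nhds (g p)) (nhds (cmap c p))"
    using C2_map_local[OF M N g c d] .
  obtain s' s'' where s: "has_second_derivative ((\<lambda>x. S x d) \<circ> cinv d) s' s'' (cmap d (g p))"
    and id: "s' (cmap d (g p)) = id_blinfun"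
    using linearizing_map_local[OF N S] unfolding d_def by metis
  \<comment> \<open>Gives the base point the form \<open>h x\<close> that the chain rule
    expects.\<close>
  have z: "(cmap d \<circ> g \<circ> cinv c) (cmap c p) = cmap d (g p)" by (simp add: c'(4))
  note ms = has_second_derivative_compose[OF has_second_derivative_linear[OF m] s]
  note fms = has_second_derivative_add[OF f' has_second_derivative_compose[OF ms[folded z] G]]
  have ev: "\<forall>\<^sub>F y in nhds (cmap c p). (lagrangian f g S \<mu> \<circ> cinv c) y = (f \<circ> cinv c) y +
      m (((\<lambda>x. S x d) \<circ> cinv d) ((cmap d \<circ> g \<circ> cinv c) y))"
    using eventually_compose_filterlim[OF linearizing_map_near[OF N S d] lim]
    by eventually_elim (simp add: lagrangian_def m_def)
  have stat: "f' (cmap c p) + (Blinfun m o\<^sub>L s' (cmap d (g p)) o\<^sub>L G' (cmap c p)) = 0"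
  proof (rule blinfun_eqI)
    fix h
    have "frechet_derivative (f \<circ> cinv c) (at (cmap c p)) = blinfun_apply (f' (cmap c p))"
      "frechet_derivative (cmap d \<circ> g \<circ> cinv c) (at (cmap c p)) = blinfun_apply (G' (cmap c p))"
      using frechet_derivative_at[OF has_second_derivativeD(2)[OF f']]
        frechet_derivative_at[OF has_second_derivativeD(2)[OF G]] by simp_all
    \<comment> \<open>Every \<open>h\<close> is the representative of a tangent vector, so the KKT
      equation reaches all directions.\<close>
    moreover have "fun_deriv M f p (tangent_of M p c h) + \<mu> (tangent_map M N g p (tangent_of M p c h)) = 0"
      using kkt tangent_of_in_tangent_space[OF M c] by (simp add: KKT_def)
    ultimately show "blinfun_apply (f' (cmap c p) + (Blinfun m o\<^sub>L s' (cmap d (g p)) o\<^sub>L G' (cmap c p))) h =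
        blinfun_apply 0 h"
      unfolding tangent_map_eq_tangent_of[OF M N g d] fun_deriv_def Let_def c_def[symmetric]
      by (simp add: tangent_of_apply[OF M c] plus_blinfun.rep_eq id bounded_linear_Blinfun_apply[OF m] m_def)
  qed
  show ?thesis
  proof (rule that[OF has_second_derivative_cong[OF fms]])
    show "\<forall>\<^sub>F y in nhds (cmap c p). (f \<circ> cinv c) y +
        m (((\<lambda>x. S x d) \<circ> cinv d) ((cmap d \<circ> g \<circ> cinv c) y)) = (lagrangian f g S \<mu> \<circ> cinv c) y"
      using ev by eventually_elim simp
  qed (use stat ev in \<open>simp_all add: c'(4) m_def\<close>)
qed

theorem proposition8p2:
  fixes M :: "('p::{t2_space, second_countable_topology}, 'e::coordinate_space) chart set"
    and N :: "('q::{t2_space, second_countable_topology}, 'f::coordinate_space) chart set"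
    and K :: "'q set" and k :: nat
    and f :: "'p \<Rightarrow> real" and g :: "'p \<Rightarrow> 'q"
    and p :: 'p and \<mu> :: "('q, 'f) tangent \<Rightarrow> real"
  assumes "C2_manifold M" and "C2_manifold N"
    and "submanifold_with_corners N K k"
    and "C2_fun_on M UNIV f" and "C2_map M N g"
    and "g p \<in> K"
    and "KKT M N K k f g p \<mu>"
  shows "(\<forall>U1 S1 U2 S2.
        adapted_linearizing_map N K k (g p) U1 S1 \<and>
        adapted_linearizing_map N K k (g p) U2 S2 \<longrightarrow>
        (\<forall>v\<in>critical_cone M N K k f g p.
          manifold_second_derivative M (lagrangian f g S1 \<mu>) p v v =
          manifold_second_derivative M (lagrangian f g S2 \<mu>) p v v)) \<and>
      (\<forall>V R U S.
        local_retraction M p V R \<and> adapted_linearizing_map N K k (g p) U S \<longrightarrow>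
        (\<forall>v\<in>critical_cone M N K k f g p.
          manifold_second_derivative M (lagrangian f g S \<mu>) p v v =
          tangent_second_derivative M p (pullback_lagrangian f g R S \<mu>) v v))"
proof -
  note M = assms(1) and N = assms(2) and f = assms(4) and g = assms(5) and kkt = assms(7)
  define c where "c = some_chart M p"
  define d where "d = some_chart N (g p)"
  have c: "c \<in> charts_at M p" unfolding c_def by (rule some_chart_in_charts_at[OF M])
  have d: "d \<in> charts_at N (g p)" unfolding d_def by (rule some_chart_in_charts_at[OF N])
  note c' = charts_atD[OF M c]
  have \<mu>: "\<mu> \<in> polar_cone N (g p) (inner_tangent_cone N K k (g p))"
    using kkt by (simp add: KKT_def)
  define m where "m x = \<mu> (tangent_of N (g p) d x)" for x
  have m: "bounded_linear m"
    unfolding m_def using \<mu> by (intro bounded_linear_cotangent[OF N d]) (simp add: polar_cone_def)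
  obtain G' G'' where G: "has_second_derivative (cmap d \<circ> g \<circ> cinv c) G' G'' (cmap c p)"
    using C2_map_local[OF M N g c d] .
  have z: "(cmap d \<circ> g \<circ> cinv c) (cmap c p) = cmap d (g p)" by (simp add: c'(4))

  \<comment> \<open>Proved for an arbitrary ordered pair, so that exchanging the two maps gives the
    reverse inequality.\<close>
  have le: "manifold_second_derivative M (lagrangian f g S2 \<mu>) p v v \<le>
      manifold_second_derivative M (lagrangian f g S1 \<mu>) p v v"
    if S1: "adapted_linearizing_map N K k (g p) U1 S1" and S2: "adapted_linearizing_map N K k (g p) U2 S2"
      and v: "v \<in> critical_cone M N K k f g p" for U1 S1 U2 S2 v
  proof -
    have lin: "linearizing_map N (g p) U1 S1" "linearizing_map N (g p) U2 S2"
      using S1 S2 by (auto simp: adapted_linearizing_map_def)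
    define w where "w = blinfun_apply (G' (cmap c p)) (v c)"
    have "frechet_derivative (cmap d \<circ> g \<circ> cinv c) (at (cmap c p)) = blinfun_apply (G' (cmap c p))"
      using frechet_derivative_at[OF has_second_derivativeD(2)[OF G]] by simp
    then have tw: "tangent_map M N g p v = tangent_of N (g p) d w"
      using tangent_map_eq_tangent_of[OF M N g d] by (simp add: w_def c_def)
    \<comment> \<open>The second equation is the first KKT equation combined with
      \<open>f'(p)v = 0\<close> on the critical cone.\<close>
    have w: "tangent_of N (g p) d w \<in> inner_tangent_cone N K k (g p)" "\<mu> (tangent_of N (g p) d w) = 0"
      using v kkt by (auto simp: critical_cone_def KKT_def tw[symmetric])
    obtain \<Lambda>1' \<Lambda>1'' where L1: "has_second_derivative (lagrangian f g S1 \<mu> \<circ> cinv c) \<Lambda>1' \<Lambda>1'' (cmap c p)"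
      "\<forall>\<^sub>F y in nhds (cmap c p). (lagrangian f g S1 \<mu> \<circ> cinv c) y = (f \<circ> cinv c) y +
        m (S1 (cinv d ((cmap d \<circ> g \<circ> cinv c) y)) d)"
      using lagrangian_local[OF M N f g kkt lin(1)] unfolding c_def d_def m_def by metis
    obtain \<Lambda>2' \<Lambda>2'' where L2: "has_second_derivative (lagrangian f g S2 \<mu> \<circ> cinv c) \<Lambda>2' \<Lambda>2'' (cmap c p)"
      "\<forall>\<^sub>F y in nhds (cmap c p). (lagrangian f g S2 \<mu> \<circ> cinv c) y = (f \<circ> cinv c) y +
        m (S2 (cinv d ((cmap d \<circ> g \<circ> cinv c) y)) d)"
      using lagrangian_local[OF M N f g kkt lin(2)] unfolding c_def d_def m_def by metis
    obtain s1' s1'' where s1: "has_second_derivative ((\<lambda>x. S1 x d) \<circ> cinv d) s1' s1'' (cmap d (g p))"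
      "s1' (cmap d (g p)) = id_blinfun"
      using linearizing_map_local[OF N lin(1)] unfolding d_def by metis
    obtain s2' s2'' where s2: "has_second_derivative ((\<lambda>x. S2 x d) \<circ> cinv d) s2' s2'' (cmap d (g p))"
      "s2' (cmap d (g p)) = id_blinfun"
      using linearizing_map_local[OF N lin(2)] unfolding d_def by metis
    define \<delta> where "\<delta> y = m (S2 (cinv d y) d) - m (S1 (cinv d y) d)" for y
    note \<delta>' = has_second_derivative_diff[OF
        has_second_derivative_compose[OF has_second_derivative_linear[OF m] s2(1)]
        has_second_derivative_compose[OF has_second_derivative_linear[OF m] s1(1)],
        unfolded comp_apply, folded \<delta>_def]
    \<comment> \<open>The terms with \<open>f\<close> cancel: near the base point the Lagrangians
      differ by \<delta> composed with the coordinate form of \<open>g\<close>.\<close>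
    have "second_derivative (lagrangian f g S2 \<mu> \<circ> cinv c) (cmap c p) (v c) (v c) -
        second_derivative (lagrangian f g S1 \<mu> \<circ> cinv c) (cmap c p) (v c) (v c) =
        second_derivative (\<lambda>y. \<delta> ((cmap d \<circ> g \<circ> cinv c) y)) (cmap c p) (v c) (v c)"
    proof -
      have ev: "\<forall>\<^sub>F y in nhds (cmap c p). (lagrangian f g S2 \<mu> \<circ> cinv c) y - (lagrangian f g S1 \<mu> \<circ> cinv c) y =
          \<delta> ((cmap d \<circ> g \<circ> cinv c) y)"
        using L1(2) L2(2) by eventually_elim (simp add: \<delta>_def)
      note diff = has_second_derivative_diff[OF L2(1) L1(1)]
      show ?thesis
        using second_derivative_diff[OF L2(1) L1(1)] second_derivative_eq[OF diff]
          second_derivative_eq[OF has_second_derivative_cong[OF diff ev]] by metis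
    qed
    \<comment> \<open>The derivative of \<delta> at the base point is \<open>m - m = 0\<close>, so
      the second derivative of \<open>g\<close> drops out.\<close>
    also have "\<dots> = second_derivative \<delta> (cmap d (g p)) w w"
      unfolding w_def z[symmetric]
      by (rule second_derivative_compose_stationary[OF \<delta>'[folded z] G]) (simp add: c'(4) s1(2) s2(2))
    also have "\<dots> \<le> 0"
      using adapted_linearizing_map_difference_nonpos[OF N S1 S2 \<mu>, folded d_def, OF w]
      by (simp add: \<delta>_def[abs_def] m_def)
    finally show ?thesis by (simp add: manifold_second_derivative_def flip: c_def)
  qed

  have pull: "manifold_second_derivative M (lagrangian f g S \<mu>) p v v =
      tangent_second_derivative M p (pullback_lagrangian f g R S \<mu>) v v"
    if R: "local_retraction M p V R" and S: "adapted_linearizing_map N K k (g p) U S" for V R U S v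
  proof -
    \<comment> \<open>The retraction in coordinates, with the same chart \<open>c\<close> on the
      manifold and, linearly, on the tangent space. Its derivative at 0 is therefore the
      identity.\<close>
    define \<rho> where "\<rho> = cmap c \<circ> R \<circ> tangent_of M p c"
    define X where "X = (\<lambda>v. v c) ` V"
    have into: "C2_into M X (R \<circ> tangent_of M p c)" and 0: "0 \<in> X"
      using R c by (auto simp: local_retraction_def X_def tangent_zero_def image_iff)
    have R0: "R (tangent_of M p c 0) = p"
      using R by (simp add: local_retraction_def tangent_of_linear(3)[OF M c])
    have \<rho>0: "\<rho> 0 = cmap c p" by (simp add: \<rho>_def R0)
    have "C2_on (X \<inter> (R \<circ> tangent_of M p c) -` cdom c) (cmap c \<circ> (R \<circ> tangent_of M p c))"
      using into c'(2) by (simp add: C2_into_def)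
    then have C2: "C2_on (X \<inter> (R \<circ> tangent_of M p c) -` cdom c) \<rho>"
      by (simp add: \<rho>_def o_assoc)
    have mem: "0 \<in> X \<inter> (R \<circ> tangent_of M p c) -` cdom c"
      using 0 c'(3) by (simp add: R0)
    obtain \<rho>' \<rho>'' where \<rho>: "has_second_derivative \<rho> \<rho>' \<rho>'' 0"
      using C2 mem by (rule C2_on_imp_has_second_derivative)
    have id: "blinfun_apply (\<rho>' 0) = id"
      using frechet_derivative_at[OF has_second_derivativeD(2)[OF \<rho>]] R c
      by (simp add: local_retraction_def \<rho>_def)
    \<comment> \<open>\<open>cinv c\<close> undoes \<open>cmap c\<close> only where \<open>R\<close>
      takes values in \<open>cdom c\<close>, which holds on a neighborhood of 0.\<close>
    have "\<forall>\<^sub>F x in nhds 0. x \<in> X \<inter> (R \<circ> tangent_of M p c) -` cdom c"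
      using C2 mem by (intro eventually_nhds_in_open) (simp_all add: C2_on_def)
    then have ev: "\<forall>\<^sub>F x in nhds 0. (lagrangian f g S \<mu> \<circ> cinv c) (\<rho> x) =
        (pullback_lagrangian f g R S \<mu> \<circ> tangent_of M p c) x"
      by eventually_elim
        (simp add: lagrangian_def pullback_lagrangian_def \<rho>_def topological_chartD(3)[OF c'(1)])
    obtain \<Lambda>' \<Lambda>'' where L: "has_second_derivative (lagrangian f g S \<mu> \<circ> cinv c) \<Lambda>' \<Lambda>'' (cmap c p)"
      "\<Lambda>' (cmap c p) = 0"
      using lagrangian_local[OF M N f g kkt] S unfolding c_def adapted_linearizing_map_def by metis
    note comp = has_second_derivative_compose[OF L(1)[folded \<rho>0] \<rho>]
    have "second_derivative (pullback_lagrangian f g R S \<mu> \<circ> tangent_of M p c) 0 (v c) (v c) =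
        second_derivative (\<lambda>x. (lagrangian f g S \<mu> \<circ> cinv c) (\<rho> x)) 0 (v c) (v c)"
      using second_derivative_eq[OF comp] second_derivative_eq[OF has_second_derivative_cong[OF comp ev]]
      by metis
    \<comment> \<open>Stationarity removes the second derivative of \<rho>, and its identity
      derivative leaves \<open>v c\<close> unchanged.\<close>
    also have "\<dots> = second_derivative (lagrangian f g S \<mu> \<circ> cinv c) (cmap c p) (v c) (v c)"
      using second_derivative_compose_stationary[OF L(1)[folded \<rho>0] \<rho>] L(2) by (simp add: \<rho>0 id)
    finally show ?thesis
      by (simp add: manifold_second_derivative_def tangent_second_derivative_def flip: c_def)
  qed

  show ?thesis using le pull by (blast intro: antisym)
qed

end
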